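(* Let $X$ be a real random variable with $\mathbb{E}[e^X]=1$, cumulative distribution function $F$, and (whenever it exists) density $f$. For $k>0$ let $p(-k)=\int_{-\infty}^{-k}(e^{-k}-e^x)\,dF(x)$ be the normalized put price at log-strike $-k$, and let $V(-k)$ be the Black–Scholes implied volatility at log-strike $-k$ (the unique value with $p_{BS}(-k,V(-k))=p(-k)$). Let $\alpha>0$ and assume $$\text{(IL)}\qquad \exists\,\epsilon>0:\ \mathbb{E}[e^{-\epsilon X}]<\infty .$$ Consider the conditions (i) $-\log f(-k)\in R_\alpha$; (ii) $-\log F(-k)\in R_\alpha$; (iii) $-\log p(-k)\in R_\alpha$ (as functions of $k$); (iv) $V(-k)^2/k\sim\psi\left[-1-\log p(-k)/k\right]$ as $k\to\infty$. Then (i) $\Rightarrow$ (ii) $\Rightarrow$ (iii) $\Rightarrow$ (iv). Moreover: if (ii) holds, then $-\log p(-k)\sim k-\log F(-k)$ and $V(-k)^2/k\sim\psi\left[-\log F(-k)/k\right]$; if (i) holds, then $-\log f(-k)\sim -\log F(-k)$ and $V(-k)^2/k\sim\psi\left[-\log f(-k)/k\right]$. Finally, if (i) holds and $-\log f(-k)/k\to\infty$, or (ii) holds and $-\log F(-k)/k\to\infty$, or (iii) holds and $-\log p(-k)/k\to\infty$, then, respectively, $$\frac{V(-k)^2}{k}\sim\frac{1}{-2\log f(-k)/k},\qquad \frac{V(-k)^2}{k}\sim\frac{1}{-2\log F(-k)/k},\qquad \frac{V(-k)^2}{k}\sim\frac{1}{-2\log p(-k)/k}.$$ All asymptotics are as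 $k\to+\infty$.
   Context: $X$ models risk-neutral log-returns (so $\mathbb{E}[e^X]=1$). With $\Phi$ the standard normal distribution function and $d_{1,2}(x,\sigma)=-x/\sigma\pm\sigma/2$, the normalized Black–Scholes call and put prices at log-strike $x$ with total volatility $\sigma>0$ are $c_{BS}(x,\sigma)=\Phi(d_1)-e^x\Phi(d_2)$ and $p_{BS}(x,\sigma)=e^x\Phi(-d_2)-\Phi(-d_1)$; the implied volatility $V(x)$ is equivalently defined by matching the call price $\int_x^\infty(e^y-e^x)dF(y)$ (put–call parity). The function $\psi:[0,\infty]\to[0,2]$ is $\psi[x]=2-4\left(\sqrt{x^2+x}-x\right)$. A measurable function $g$, positive for large $x$, is in $R_\alpha$ if $\lim_{x\to\infty}g(\lambda x)/g(x)=\lambda^\alpha$ for every $\lambda>0$. $g\sim h$ means $g(k)/h(k)\to1$ as $k\to\infty$. *)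

theory Defs
  imports "HOL-Probability.Probability" "HOL-Library.Landau_Symbols"
begin

definition Phi :: "real \<Rightarrow> real" where
  "Phi x = (LINT t:{..x}|lborel. std_normal_density t)"

definition d1 :: "real \<Rightarrow> real \<Rightarrow> real" where
  "d1 x \<sigma> = - x / \<sigma> + \<sigma> / 2"

definition d2 :: "real \<Rightarrow> real \<Rightarrow> real" where
  "d2 x \<sigma> = - x / \<sigma> - \<sigma> / 2"

definition c_BS :: "real \<Rightarrow> real \<Rightarrow> real" where
  "c_BS x \<sigma> = Phi (d1 x \<sigma>) - exp x * Phi (d2 x \<sigma>)"

definition p_BS :: "real \<Rightarrow> real \<Rightarrow> real" where
  "p_BS x \<sigma> = exp x * Phi (- d2 x \<sigma>) - Phi (- d1 x \<sigma>)"

definition put_price :: "real measure \<Rightarrow> real \<Rightarrow> real" where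
  "put_price M x = (LINT y:{..x}|M. exp x - exp y)"

definition impvol :: "real measure \<Rightarrow> real \<Rightarrow> real" where
  "impvol M x = (THE \<sigma>. \<sigma> > 0 \<and> p_BS x \<sigma> = put_price M x)"

definition psi :: "real \<Rightarrow> real" where
  "psi x = 2 - 4 * (sqrt (x\<^sup>2 + x) - x)"

definition regvar :: "real \<Rightarrow> (real \<Rightarrow> real) \<Rightarrow> bool" where
  "regvar \<alpha> g \<longleftrightarrow> g \<in> borel_measurable borel \<and> eventually (\<lambda>x. g x > 0) at_top \<and>
     (\<forall>c>0. ((\<lambda>x. g (c * x) / g x) \<longlongrightarrow> c powr \<alpha>) at_top)"

definition has_density :: "real measure \<Rightarrow> (real \<Rightarrow> real) \<Rightarrow> bool" where
  "has_density M f \<longleftrightarrow> f \<in> borel_measurable borel \<and> (\<forall>x. f x \<ge> 0) \<and>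
     M = density lborel (\<lambda>x. ennreal (f x))"

end

theory Submission
  imports Defs "HOL-Real_Asymp.Real_Asymp"
begin

text \<open>
  The implications between density, distribution function and put price come from Potter bounds
  for regularly varying functions: a tail integral of \<open>exp (- h)\<close> with \<open>h\<close> regularly varying of
  positive index is \<open>exp (- h (1 + o 1))\<close>, and \<open>e\<^sup>-\<^sup>k F(-(1+\<delta>)k) / 2 \<le> p(-k) \<le> e\<^sup>-\<^sup>k F(-k)\<close>.
  The moment condition gives \<open>F(-k) \<le> C e\<^sup>-\<^sup>\<epsilon>\<^sup>k\<close>; hence \<open>\<alpha> \<ge> 1\<close>, and \<open>-1 - ln p(-k) / k\<close> stays
  bounded away from \<open>0\<close>.

  For the implied volatility, the derivative in \<open>\<sigma>\<close> of the Black--Scholes put price at \<open>x = -k\<close>,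
  \<open>\<sigma> = \<surd>(k v)\<close> is \<open>exp (- k I(v)) / \<surd>(2 \<pi>)\<close> with \<open>I(v) = 1/(2v) + 1/2 + v/8\<close>, which is decreasing on
  \<open>(0, 2]\<close> and satisfies \<open>I(\<psi>(x)) = 1 + x\<close>. The price at variance \<open>k v\<close> is therefore below or above
  \<open>exp (- k (1 + x))\<close> according to whether \<open>v\<close> is \<open>(1 - \<delta>) \<psi>(x)\<close> or \<open>(1 + \<delta>) \<psi>(x)\<close>, uniformly for
  \<open>x\<close> bounded away from \<open>0\<close>.
\<close>

section \<open>Regular variation\<close>

lemma asymptotically_additive_uniform:
  fixes H :: "real \<Rightarrow> real"
  assumes meas [measurable]: "H \<in> borel_measurable borel"
    and lim: "\<And>w. ((\<lambda>u. H (u + w) - H u) \<longlongrightarrow> \<alpha> * w) at_top"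
    and "\<epsilon> > 0"
  shows "\<exists>U. \<forall>u\<ge>U. \<forall>v\<in>{0..1}. \<bar>H (u + v) - H u - \<alpha> * v\<bar> < \<epsilon>"
proof -
  \<comment> \<open>For large \<open>u\<close> the good increments fill almost all of \<open>[0, 2]\<close>, both from \<open>u\<close> and from \<open>u + v\<close>,
    so the two sets meet and give a common point from which \<open>H u\<close> and \<open>H (u + v)\<close> are compared.\<close>
  define B where "B u = {w\<in>{0..2}. \<bar>H (u + w) - H u - \<alpha> * w\<bar> < \<epsilon>/2}" for u
  have Bs [measurable]: "B u \<in> sets lborel" for u
    unfolding B_def by measurable
  \<comment> \<open>For fixed \<open>w\<close> the increment from \<open>u\<close> is eventually
    good, so the indicators converge pointwise to that of \<open>{0..2}\<close>; dominated
    convergence turns this into convergence of measures.\<close>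
  have "((\<lambda>u. \<integral>w. indicator (B u) w \<partial>lborel) \<longlongrightarrow> (\<integral>w. indicator {0..2::real} w \<partial>lborel :: real)) at_top"
  proof (rule integral_dominated_convergence_at_top[where w = "indicator {0..2}"])
    show "AE x in lborel. ((\<lambda>u. indicat_real (B u) x) \<longlongrightarrow> indicat_real {0..2} x) at_top"
    proof (rule AE_I2)
      fix x :: real
      have "eventually (\<lambda>u. dist (H (u + x) - H u) (\<alpha> * x) < \<epsilon>/2) at_top"
        using lim \<open>\<epsilon> > 0\<close> by (intro tendstoD) auto
      then have "eventually (\<lambda>u. indicat_real (B u) x = indicat_real {0..2} x) at_top"
        by eventually_elim (auto simp: B_def indicator_def dist_real_def)
      then show "((\<lambda>u. indicat_real (B u) x) \<longlongrightarrow> indicat_real {0..2} x) at_top"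
        by (rule tendsto_eventually)
    qed
    show "\<forall>\<^sub>F i in at_top. AE x in lborel. norm (indicat_real (B i) x) \<le> indicat_real {0..2} x"
      by (auto simp: B_def indicator_def)
  qed auto
  then have "((\<lambda>u. measure lborel (B u)) \<longlongrightarrow> 2) at_top"
    by simp
  \<comment> \<open>Any threshold from 3/2 up to 2 would do: \<open>B u\<close> and the translate of
    \<open>B (u + v)\<close> by \<open>v\<close> both lie in \<open>{0..3}\<close>, which has no
    room for two disjoint sets of measure above 3/2.\<close>
  then have "eventually (\<lambda>u. measure lborel (B u) > 7/4) at_top"
    by (rule order_tendstoD) simp
  then obtain U where U: "\<And>u. u \<ge> U \<Longrightarrow> measure lborel (B u) > 7/4"
    by (auto simp: eventually_at_top_linorder)
  have B02: "B u \<subseteq> {0..2}" for u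
    by (auto simp: B_def)
  have fin: "B u \<in> lmeasurable" for u
    using bounded_set_imp_lmeasurable[of "B u"] B02 Bs[of u] bounded_subset[OF bounded_closed_interval]
    by (metis sets_completionI_sets)
  have "\<bar>H (u + v) - H u - \<alpha> * v\<bar> < \<epsilon>" if "u \<ge> U" "v \<in> {0..1}" for u v
  proof -
    let ?T = "(+) v ` B (u + v)"
    have "B u \<inter> ?T \<noteq> {}"
    proof
      assume "B u \<inter> ?T = {}"
      moreover have "?T \<in> lmeasurable"
        using fin by (simp add: measurable_translation)
      ultimately have "measure lebesgue (B u \<union> ?T) = measure lebesgue (B u) + measure lebesgue ?T"
        using fin by (metis measure_Un2 Diff_triv inf_commute)
      moreover have "measure lebesgue (B u \<union> ?T) \<le> measure lebesgue {0..3::real}"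
        using B02[of u] B02[of "u+v"] that fin \<open>?T \<in> lmeasurable\<close>
        by (intro measure_mono_fmeasurable) (force simp: fmeasurableD)+
      ultimately show False
        using U[of u] U[of "u + v"] that
        by (simp only: measure_translation measure_completion[OF Bs]) simp
    qed
    then obtain w where w: "v + w \<in> B u" "w \<in> B (u + v)"
      by auto
    then have "\<bar>H (u + (v + w)) - H u - \<alpha> * (v + w)\<bar> < \<epsilon>/2"
      "\<bar>H (u + v + w) - H (u + v) - \<alpha> * w\<bar> < \<epsilon>/2"
      by (auto simp: B_def)
    moreover have "H (u + v) - H u - \<alpha> * v = (H (u + (v + w)) - H u - \<alpha> * (v + w))
        - (H (u + v + w) - H (u + v) - \<alpha> * w)"
      by (simp add: algebra_simps)
    ultimately show ?thesis
      unfolding abs_less_iff by linarith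
  qed
  then show ?thesis by blast
qed

text \<open>Each unit step costs at most \<open>\<epsilon>\<close> by the uniform estimate, and so
  does the fractional remainder; the integer part of \<open>w\<close> counts the steps.\<close>

lemma asymptotically_additive_linear_bound:
  fixes H :: "real \<Rightarrow> real"
  assumes "H \<in> borel_measurable borel"
    and "\<And>w. ((\<lambda>u. H (u + w) - H u) \<longlongrightarrow> \<alpha> * w) at_top"
    and "\<epsilon> > 0"
  shows "\<exists>U. \<forall>u\<ge>U. \<forall>w\<ge>0. \<bar>H (u + w) - H u - \<alpha> * w\<bar> \<le> \<epsilon> * (w + 1)"
proof -
  obtain U where U: "\<And>u v. u \<ge> U \<Longrightarrow> v \<in> {0..1} \<Longrightarrow> \<bar>H (u + v) - H u - \<alpha> * v\<bar> < \<epsilon>"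
    using asymptotically_additive_uniform[OF assms] by blast
  have step: "\<bar>H (u + real n) - H u - \<alpha> * real n\<bar> \<le> \<epsilon> * real n" if "u \<ge> U" for u n
  proof (induction n)
    case (Suc n)
    have "\<bar>H (u + real n + 1) - H (u + real n) - \<alpha> * 1\<bar> < \<epsilon>"
      using that by (intro U) auto
    then show ?case
      using Suc by (simp add: algebra_simps abs_le_iff abs_less_iff)
  qed auto
  have "\<bar>H (u + w) - H u - \<alpha> * w\<bar> \<le> \<epsilon> * (w + 1)" if u: "u \<ge> U" and w: "w \<ge> 0" for u w
  proof -
    define n where "n = nat \<lfloor>w\<rfloor>"
    define v where "v = w - real n"
    have n: "real n \<le> w" "w \<le> real n + 1"
      unfolding n_def using w by linarith+
    then have v: "v \<in> {0..1}"
      by (simp add: v_def)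
    have "\<bar>H (u + real n + v) - H (u + real n) - \<alpha> * v\<bar> < \<epsilon>"
      using u v by (intro U) auto
    moreover have "\<epsilon> * real n \<le> \<epsilon> * w"
      using n \<open>\<epsilon> > 0\<close> by simp
    moreover have "u + real n + v = u + w" "\<alpha> * v = \<alpha> * w - \<alpha> * real n" "\<epsilon> * (w + 1) = \<epsilon> * w + \<epsilon>"
      by (simp_all add: v_def algebra_simps)
    ultimately show ?thesis
      using step[OF u, of n] by simp
  qed
  then show ?thesis by blast
qed

text \<open>In the logarithmic variable \<open>H u = ln (g (exp u))\<close>, regular variation
  becomes asymptotic additivity. Exponentiating the linear bound at \<open>w = ln (y / x)\<close>
  gives both inequalities: \<open>\<delta> * w\<close> perturbs the exponent, and the extra
  \<open>\<delta>\<close> becomes the factor \<open>exp \<delta>\<close>.\<close>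

lemma regvar_Potter:
  assumes g: "regvar \<alpha> g" and "\<delta> > 0"
  shows "\<exists>X>0. \<forall>x\<ge>X. \<forall>y\<ge>x. g x > 0 \<and>
    exp (- \<delta>) * (y / x) powr (\<alpha> - \<delta>) * g x \<le> g y \<and>
    g y \<le> exp \<delta> * (y / x) powr (\<alpha> + \<delta>) * g x"
proof -
  define H where "H u = ln (g (exp u))" for u
  have [measurable]: "g \<in> borel_measurable borel"
    using g by (simp add: regvar_def)
  have H: "H \<in> borel_measurable borel"
    unfolding H_def by measurable
  obtain X0 where X0: "\<And>x. x \<ge> X0 \<Longrightarrow> g x > 0"
    using g by (auto simp: regvar_def eventually_at_top_linorder)
  have lim: "((\<lambda>u. H (u + w) - H u) \<longlongrightarrow> \<alpha> * w) at_top" for w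
  proof -
    have "((\<lambda>x. g (exp w * x) / g x) \<longlongrightarrow> exp w powr \<alpha>) at_top"
      using g by (simp add: regvar_def)
    then have "((\<lambda>u. g (exp w * exp u) / g (exp u)) \<longlongrightarrow> exp w powr \<alpha>) at_top"
      by (rule filterlim_compose) (rule exp_at_top)
    then have "((\<lambda>u. ln (g (exp w * exp u) / g (exp u))) \<longlongrightarrow> ln (exp w powr \<alpha>)) at_top"
      by (intro tendsto_ln) auto
    moreover have "ln (exp w powr \<alpha>) = \<alpha> * w"
      by (simp add: powr_def)
    moreover have "eventually (\<lambda>u. ln (g (exp w * exp u) / g (exp u)) = H (u + w) - H u) at_top"
    proof -
      have "eventually (\<lambda>u. exp u \<ge> X0) at_top"
        using exp_at_top by (auto simp: filterlim_at_top)
      moreover have "eventually (\<lambda>u. exp (u + w) \<ge> X0) at_top"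
        by real_asymp
      ultimately show ?thesis
      proof eventually_elim
        case (elim u)
        then show ?case
          using X0[OF elim(1)] X0[OF elim(2)]
          by (simp add: H_def ln_div exp_add mult.commute)
      qed
    qed
    ultimately show ?thesis
      using Lim_transform_eventually by fastforce
  qed
  obtain U where U: "\<And>u w. u \<ge> U \<Longrightarrow> w \<ge> 0 \<Longrightarrow> \<bar>H (u + w) - H u - \<alpha> * w\<bar> \<le> \<delta> * (w + 1)"
    using asymptotically_additive_linear_bound[OF H lim \<open>\<delta> > 0\<close>] by blast
  define X where "X = max (exp U) X0"
  have "X > 0" by (simp add: X_def less_max_iff_disj)
  moreover have "g x > 0 \<and> exp (- \<delta>) * (y / x) powr (\<alpha> - \<delta>) * g x \<le> g y \<and>
    g y \<le> exp \<delta> * (y / x) powr (\<alpha> + \<delta>) * g x" if x: "x \<ge> X" and y: "y \<ge> x" for x y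
  proof -
    have pos: "x > 0" "y > 0" "g x > 0" "g y > 0"
      using x y \<open>X > 0\<close> X0[of x] X0[of y] by (auto simp: X_def)
    define w where "w = ln (y / x)"
    have "w \<ge> 0" using pos y by (simp add: w_def)
    moreover have "ln x \<ge> U"
      using x pos by (simp add: X_def ln_ge_iff)
    ultimately have "\<bar>H (ln x + w) - H (ln x) - \<alpha> * w\<bar> \<le> \<delta> * (w + 1)"
      by (intro U)
    moreover have "H (ln x + w) = ln (g y)" "H (ln x) = ln (g x)"
      using pos by (simp_all add: H_def w_def ln_div)
    ultimately have *: "- \<delta> + (\<alpha> - \<delta>) * w + ln (g x) \<le> ln (g y)"
      "ln (g y) \<le> \<delta> + (\<alpha> + \<delta>) * w + ln (g x)"
      by (simp_all add: abs_le_iff algebra_simps)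
    have "exp (- \<delta> + (\<alpha> - \<delta>) * w + ln (g x)) = exp (- \<delta>) * (y / x) powr (\<alpha> - \<delta>) * g x"
      "exp (\<delta> + (\<alpha> + \<delta>) * w + ln (g x)) = exp \<delta> * (y / x) powr (\<alpha> + \<delta>) * g x"
      using pos by (simp_all add: exp_add exp_diff exp_minus powr_def w_def field_simps)
    then show ?thesis
      using * pos by (metis exp_le_cancel_iff exp_ln)
  qed
  ultimately show ?thesis by blast
qed

text \<open>Potter's lower bound from a fixed base point \<open>X\<close> gives growth of order
  \<open>x powr (\<alpha> - \<delta>)\<close>. Taking \<open>\<delta>\<close> as half the gap leaves
  this exponent above \<open>\<beta>\<close>, which absorbs the constant.\<close>

lemma regvar_ge_powr:
  assumes g: "regvar \<alpha> g" and "\<beta> < \<alpha>"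
  shows "\<forall>\<^sub>F x in at_top. g x \<ge> x powr \<beta>"
proof -
  define \<delta> where "\<delta> = (\<alpha> - \<beta>) / 2"
  have "\<delta> > 0" "\<alpha> - \<delta> > \<beta>"
    using assms(2) by (auto simp: \<delta>_def field_simps)
  obtain X where X: "X > 0" "\<And>x y. x \<ge> X \<Longrightarrow> y \<ge> x \<Longrightarrow> g x > 0 \<and> exp (- \<delta>) * (y / x) powr (\<alpha> - \<delta>) * g x \<le> g y"
    using regvar_Potter[OF g \<open>\<delta> > 0\<close>] by blast
  define C where "C = exp (- \<delta>) * g X"
  have "C > 0"
    using X(2)[of X X] by (simp add: C_def)
  have "\<forall>\<^sub>F x in at_top. x powr \<beta> \<le> (x / X) powr (\<alpha> - \<delta>) * C"
    using \<open>C > 0\<close> \<open>X > 0\<close> \<open>\<alpha> - \<delta> > \<beta>\<close> by real_asymp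
  then show ?thesis
    using eventually_ge_at_top[of X]
  proof eventually_elim
    case (elim x)
    then show ?case
      using X(2)[of X x] by (simp add: C_def mult_ac)
  qed
qed

section \<open>Stability of regular variation\<close>

lemma regvar_inverse:
  assumes "regvar \<alpha> g"
  shows "regvar (- \<alpha>) (\<lambda>x. inverse (g x))"
  unfolding regvar_def
proof (intro conjI allI impI)
  show "(\<lambda>x. inverse (g x)) \<in> borel_measurable borel"
    using assms by (auto simp: regvar_def)
  show "\<forall>\<^sub>F x in at_top. 0 < inverse (g x)"
    using assms by (auto simp: regvar_def)
  fix c :: real assume "c > 0"
  then have "((\<lambda>x. inverse (g (c * x) / g x)) \<longlongrightarrow> inverse (c powr \<alpha>)) at_top"
    using assms by (intro tendsto_inverse) (auto simp: regvar_def)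
  then show "((\<lambda>x. inverse (g (c * x)) / inverse (g x)) \<longlongrightarrow> c powr - \<alpha>) at_top"
    by (simp add: powr_minus field_simps)
qed

text \<open>The quotient \<open>f (c * x) / f x\<close> is \<open>g (c * x) / g x\<close> times two
  correction factors built from \<open>f / g\<close>, at \<open>c * x\<close> and at
  \<open>x\<close>, both tending to 1.\<close>

lemma regvar_asymp_equiv:
  assumes g: "regvar \<alpha> g" and eq: "f \<sim>[at_top] g"
    and f: "f \<in> borel_measurable borel" "\<forall>\<^sub>F x in at_top. f x > 0"
  shows "regvar \<alpha> f"
  unfolding regvar_def
proof (intro conjI allI impI f)
  fix c :: real assume c: "c > 0"
  \<comment> \<open>Asymptotic equivalence reads the quotient as 1 where both functions vanish;
    positivity of \<open>f\<close> makes it an honest quotient.\<close>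
  have lim: "((\<lambda>x. f x / g x) \<longlongrightarrow> 1) at_top"
    by (rule asymp_equivD_strong[OF eq eventually_mono[OF f(2)]]) simp
  have ct: "filterlim (\<lambda>x. c * x) at_top at_top"
    using c by real_asymp
  have "((\<lambda>x. (f (c * x) / g (c * x)) * (g (c * x) / g x) / (f x / g x)) \<longlongrightarrow> 1 * c powr \<alpha> / 1) at_top"
    using filterlim_compose[OF lim ct] lim g c by (intro tendsto_intros) (auto simp: regvar_def)
  moreover have "\<forall>\<^sub>F x in at_top. (f (c * x) / g (c * x)) * (g (c * x) / g x) / (f x / g x) = f (c * x) / f x"
  proof -
    have pos: "\<forall>\<^sub>F x in at_top. g x > 0"
      using g by (simp add: regvar_def)
    show ?thesis
      using pos eventually_compose_filterlim[OF pos ct] by eventually_elim simp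
  qed
  ultimately show "((\<lambda>x. f (c * x) / f x) \<longlongrightarrow> c powr \<alpha>) at_top"
    using Lim_transform_eventually by fastforce
qed

lemma asymp_equiv_realI:
  fixes f g :: "'a \<Rightarrow> real"
  assumes bounds: "\<And>\<epsilon>. 0 < \<epsilon> \<Longrightarrow> \<epsilon> < 1 \<Longrightarrow>
      \<forall>\<^sub>F x in F. (1 - \<epsilon>) * g x \<le> f x \<and> f x \<le> (1 + \<epsilon>) * g x"
    and pos: "\<forall>\<^sub>F x in F. g x > 0"
  shows "f \<sim>[F] g"
proof (rule asymp_equivI', rule tendstoI)
  fix e :: real assume "e > 0"
  define \<epsilon> where "\<epsilon> = min (e / 2) (1 / 2)"
  have \<epsilon>: "0 < \<epsilon>" "\<epsilon> < 1" "\<epsilon> < e"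
    using \<open>e > 0\<close> by (auto simp: \<epsilon>_def)
  from bounds[OF \<epsilon>(1,2)] pos show "\<forall>\<^sub>F x in F. dist (f x / g x) 1 < e"
  proof eventually_elim
    case (elim x)
    then have "1 - \<epsilon> \<le> f x / g x" "f x / g x \<le> 1 + \<epsilon>"
      by (simp_all add: field_simps)
    then show ?case
      using \<epsilon> by (simp add: dist_real_def abs_less_iff)
  qed
qed

text \<open>The quotient for \<open>k + g k\<close> is a weighted mean of \<open>a\<close> and
  \<open>g (a * k) / g k\<close>, the weight of \<open>a\<close> being
  \<open>r k = k / (k + g k)\<close>. The linear lower bound forces \<open>\<alpha> \<ge> 1\<close>.
  If \<open>\<alpha> = 1\<close>, both values tend to \<open>a\<close>; if
  \<open>\<alpha> > 1\<close>, the weight \<open>r\<close> vanishes.\<close>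

lemma regvar_add_ident:
  assumes g: "regvar \<alpha> g" and c: "c > 0" and ge: "\<forall>\<^sub>F k in at_top. c * k \<le> g k"
  shows "regvar \<alpha> (\<lambda>k. k + g k)"
  unfolding regvar_def
proof (intro conjI allI impI)
  show "(\<lambda>k. k + g k) \<in> borel_measurable borel"
    using g by (auto simp: regvar_def)
  have gpos: "\<forall>\<^sub>F k in at_top. g k > 0"
    using g by (simp add: regvar_def)
  then show "\<forall>\<^sub>F k in at_top. k + g k > 0"
    using eventually_gt_at_top[of 0] by eventually_elim auto
  have "\<alpha> \<ge> 1"
    \<comment> \<open>a regularly varying function of index less than \<open>1\<close> is sublinear\<close>
  proof (rule ccontr)
    assume "\<not> \<alpha> \<ge> 1"
    define \<beta> where "\<beta> = (1 + \<alpha>) / 2"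
    have \<beta>: "\<alpha> < \<beta>" "\<beta> < 1"
      using \<open>\<not> \<alpha> \<ge> 1\<close> by (auto simp: \<beta>_def)
    \<comment> \<open>The power bound for \<open>inverse (g k)\<close>, of index
      \<open>- \<alpha>\<close>, is an upper bound \<open>g k \<le> k powr \<beta>\<close>, in
      conflict with \<open>c * k \<le> g k\<close> since \<open>\<beta> < 1\<close>.\<close>
    have "\<forall>\<^sub>F k in at_top. k powr (- \<beta>) \<le> inverse (g k)"
      using \<beta> by (intro regvar_ge_powr[OF regvar_inverse[OF g]]) auto
    moreover have "\<forall>\<^sub>F k in at_top. k powr \<beta> < c * k"
      using \<beta> c by real_asymp
    ultimately have "\<forall>\<^sub>F k::real in at_top. False"
      using gpos ge eventually_gt_at_top[of 0]
      by eventually_elim (simp add: powr_minus inverse_le_iff_le)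
    then show False by simp
  qed
  fix a :: real assume a: "a > 0"
  define r where "r k = k / (k + g k)" for k
  have r: "\<forall>\<^sub>F k in at_top. 0 \<le> r k \<and> r k \<le> 1"
    using gpos eventually_gt_at_top[of 0] by eventually_elim (auto simp: r_def)
  have q: "((\<lambda>k. g (a * k) / g k - a powr \<alpha>) \<longlongrightarrow> 0) at_top"
    using g a by (subst LIM_zero_iff) (auto simp: regvar_def)
  have 1: "((\<lambda>k. (g (a * k) / g k - a powr \<alpha>) * (1 - r k)) \<longlongrightarrow> 0) at_top"
  proof (rule Lim_null_comparison)
    show "((\<lambda>k. \<bar>g (a * k) / g k - a powr \<alpha>\<bar>) \<longlongrightarrow> 0) at_top"
      using q by (rule tendsto_rabs_zero)
    show "\<forall>\<^sub>F k in at_top. norm ((g (a * k) / g k - a powr \<alpha>) * (1 - r k)) \<le> \<bar>g (a * k) / g k - a powr \<alpha>\<bar>"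
      using r by eventually_elim (auto simp: abs_mult intro!: mult_left_le)
  qed
  have 2: "((\<lambda>k. (a - a powr \<alpha>) * r k) \<longlongrightarrow> 0) at_top"
  proof (cases "\<alpha> = 1")
    case True
    then show ?thesis using a by simp
  next
    case False
    define \<beta> where "\<beta> = (1 + \<alpha>) / 2"
    have \<beta>: "\<beta> < \<alpha>" "1 < \<beta>"
      using \<open>\<alpha> \<ge> 1\<close> False by (auto simp: \<beta>_def)
    have "(r \<longlongrightarrow> 0) at_top"
    proof (rule Lim_null_comparison)
      show "((\<lambda>k::real. k / k powr \<beta>) \<longlongrightarrow> 0) at_top"
        using \<beta> by real_asymp
      show "\<forall>\<^sub>F k in at_top. norm (r k) \<le> k / k powr \<beta>"
        using regvar_ge_powr[OF g \<beta>(1)] r gpos eventually_gt_at_top[of 0]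
      proof eventually_elim
        case (elim k)
        then have "r k \<le> k / k powr \<beta>"
          unfolding r_def by (intro divide_left_mono mult_pos_pos) auto
        with elim show ?case by simp
      qed
    qed
    then show ?thesis
      by (intro tendsto_mult_right_zero)
  qed
  have "((\<lambda>k. a powr \<alpha> + (g (a * k) / g k - a powr \<alpha>) * (1 - r k) + (a - a powr \<alpha>) * r k)
      \<longlongrightarrow> a powr \<alpha> + 0 + 0) at_top"
    by (intro tendsto_intros 1 2)
  moreover have "\<forall>\<^sub>F k in at_top. a powr \<alpha> + (g (a * k) / g k - a powr \<alpha>) * (1 - r k) + (a - a powr \<alpha>) * r k
      = (a * k + g (a * k)) / (k + g k)"
    using gpos eventually_gt_at_top[of 0]
  proof eventually_elim
    case (elim k)
    then have "k + g k > 0" by simp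
    then have "1 - r k = g k / (k + g k)"
      by (simp add: r_def field_simps)
    then have "g (a * k) / g k * (1 - r k) + a * r k = (a * k + g (a * k)) / (k + g k)"
      using elim by (simp add: r_def add_divide_distrib)
    then show ?case
      by (simp add: algebra_simps)
  qed
  ultimately show "((\<lambda>k. (a * k + g (a * k)) / (k + g k)) \<longlongrightarrow> a powr \<alpha>) at_top"
    using Lim_transform_eventually by fastforce
qed

section \<open>Tails of a density\<close>

lemma emeasure_atMost_has_density:
  assumes "has_density M f"
  shows "emeasure M {..-k} = (\<integral>\<^sup>+ t. ennreal (f (-t)) * indicator {k..} t \<partial>lborel)"
proof -
  have [measurable]: "f \<in> borel_measurable borel"
    using assms by (simp add: has_density_def)
  have "emeasure M {..-k} = (\<integral>\<^sup>+ x. ennreal (f x) * indicator {..-k} x \<partial>lborel)"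
    using assms by (simp add: has_density_def emeasure_density)
  also have "\<dots> = (\<integral>\<^sup>+ t. ennreal (f (-t)) * indicator {..-k} (-t) \<partial>lborel)"
    using nn_integral_real_affine[of "\<lambda>x. ennreal (f x) * indicator {..-k} x" "-1" 0] by simp
  also have "\<dots> = (\<integral>\<^sup>+ t. ennreal (f (-t)) * indicator {k..} t \<partial>lborel)"
    by (intro nn_integral_cong) (auto split: split_indicator)
  finally show ?thesis .
qed

text \<open>Supplies the integrable factor \<open>1 / t\<^sup>2\<close> that is split off from the
  density in the upper tail estimate.\<close>

lemma nn_integral_inverse_square_atLeast:
  assumes "k > 0"
  shows "(\<integral>\<^sup>+ t. ennreal (1 / t\<^sup>2) * indicator {k..} t \<partial>lborel) = ennreal (1 / k)"
proof -
  have "(\<integral>\<^sup>+ t. ennreal (1 / t\<^sup>2) * indicator {k..} t \<partial>lborel) = ennreal (0 - (- (1 / k)))"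
  proof (rule nn_integral_FTC_atLeast[where F = "\<lambda>t. - (1 / t)" and T = 0])
    fix x :: real assume "k \<le> x"
    then show "((\<lambda>x. - (1 / x)) has_real_derivative 1 / x\<^sup>2) (at x)"
      using assms by (auto intro!: derivative_eq_intros simp: power2_eq_square)
  next
    show "((\<lambda>x::real. - (1 / x)) \<longlongrightarrow> 0) at_top"
      by real_asymp
  qed auto
  then show ?thesis by simp
qed

text \<open>For the upper bound, a small share of \<open>h t\<close> pays for the factor
  \<open>1 / t\<^sup>2\<close> and Potter's bound compares the rest with \<open>h k\<close>. For the
  lower bound, integration over \<open>[k, (1 + \<delta>) * k]\<close> suffices, since
  \<open>h\<close> grows there by a factor of at most \<open>1 + \<epsilon>\<close>.\<close>

lemma density_tail_asymp_equiv:
  assumes "prob_space M" and f: "has_density M f"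
    and h: "regvar \<alpha> (\<lambda>k. - ln (f (-k)))" and \<alpha>: "\<alpha> > 0"
  shows "(\<lambda>k. - ln (cdf M (-k))) \<sim>[at_top] (\<lambda>k. - ln (f (-k)))"
proof (rule asymp_equiv_realI)
  interpret prob_space M by fact
  define h where "h k = - ln (f (-k))" for k
  have hreg: "regvar \<alpha> h"
    using assms(3) by (simp add: h_def[abs_def])
  show "\<forall>\<^sub>F k in at_top. - ln (f (-k)) > 0"
    using assms(3) by (simp add: regvar_def)
  have f_nonneg: "f x \<ge> 0" for x
    using f by (simp add: has_density_def)
  obtain X0 where X0: "\<And>k. k \<ge> X0 \<Longrightarrow> h k > 0"
    using hreg by (auto simp: regvar_def eventually_at_top_linorder)
  \<comment> \<open>\<open>ln 0 = 0\<close>, so positivity of \<open>h\<close> excludes zeros of the density.\<close>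
  have f_eq: "f (-t) = exp (- h t)" if "t \<ge> X0" for t
    using X0[OF that] f_nonneg[of "-t"] by (cases "f (-t) = 0") (auto simp: h_def)
  fix \<epsilon> :: real assume \<epsilon>: "0 < \<epsilon>" "\<epsilon> < 1"

  have upper: "\<forall>\<^sub>F k in at_top. cdf M (-k) \<le> exp (- (1 - \<epsilon>) * h k)"
  proof -
    \<comment> \<open>One factor \<open>1 - \<eta>\<close> is lost to Potter's constant, as
      \<open>exp (- \<eta>) \<ge> 1 - \<eta>\<close>, and one to the share
      \<open>\<eta> * h t\<close>; \<open>2 * \<eta> \<le> \<epsilon>\<close> gives
      \<open>(1 - \<eta>)\<^sup>2 \<ge> 1 - \<epsilon>\<close>. The bound
      \<open>\<eta> \<le> \<alpha>\<close> keeps the exponent of \<open>t / k\<close>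
      nonnegative.\<close>
    define \<eta> where "\<eta> = min \<alpha> (\<epsilon> / 2)"
    have \<eta>: "0 < \<eta>" "\<eta> \<le> \<alpha>" "\<eta> < 1" "2 * \<eta> \<le> \<epsilon>"
      using \<alpha> \<epsilon> by (auto simp: \<eta>_def)
    obtain X1 where X1: "X1 > 0" "\<And>x y. x \<ge> X1 \<Longrightarrow> y \<ge> x \<Longrightarrow> h x > 0 \<and> exp (- \<eta>) * (y / x) powr (\<alpha> - \<eta>) * h x \<le> h y"
      using regvar_Potter[OF hreg \<open>0 < \<eta>\<close>] by blast
    \<comment> \<open>Power growth of \<open>h\<close> beats the logarithm, so the share
      \<open>\<eta> * h t\<close> eventually exceeds \<open>2 * ln t\<close>, that is,
      \<open>exp (- \<eta> * h t) \<le> 1 / t\<^sup>2\<close>.\<close>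
    have "\<forall>\<^sub>F t in at_top. 2 / \<eta> * ln t \<le> t powr (\<alpha> / 2)"
      using \<eta> \<alpha> by real_asymp
    moreover have "\<forall>\<^sub>F t in at_top. t powr (\<alpha> / 2) \<le> h t"
      using \<alpha> by (intro regvar_ge_powr[OF hreg]) auto
    ultimately have "\<forall>\<^sub>F t in at_top. 2 / \<eta> * ln t \<le> h t"
      by eventually_elim simp
    then obtain X2 where X2: "\<And>t. t \<ge> X2 \<Longrightarrow> 2 / \<eta> * ln t \<le> h t"
      by (auto simp: eventually_at_top_linorder)
    have "cdf M (-k) \<le> exp (- (1 - \<epsilon>) * h k)" if k: "k \<ge> Max {X0, X1, X2, 1}" for k
    proof -
      have k': "k \<ge> X0" "k \<ge> X1" "k \<ge> X2" "k \<ge> 1"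
        using k by auto
      have "f (-t) \<le> exp (- (1 - \<epsilon>) * h k) * (1 / t\<^sup>2)" if t: "t \<ge> k" for t
      proof -
        have "1 powr (\<alpha> - \<eta>) \<le> (t / k) powr (\<alpha> - \<eta>)"
          using t k' \<eta> by (intro powr_mono2) auto
        then have "(1 - \<eta>) * 1 \<le> exp (- \<eta>) * (t / k) powr (\<alpha> - \<eta>)"
          using exp_ge_add_one_self[of "- \<eta>"] \<eta> by (intro mult_mono) auto
        then have "(1 - \<eta>) * h k \<le> exp (- \<eta>) * (t / k) powr (\<alpha> - \<eta>) * h k"
          using X0[of k] k' by (intro mult_right_mono) auto
        also have "\<dots> \<le> h t"
          using X1(2)[of k t] k' t by simp
        finally have "(1 - \<eta>) * ((1 - \<eta>) * h k) \<le> (1 - \<eta>) * h t"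
          using \<eta> by (intro mult_left_mono) auto
        moreover have "(1 - \<epsilon>) * h k \<le> (1 - \<eta>) * (1 - \<eta>) * h k"
          using X0[of k] k' \<eta> by (intro mult_right_mono) (auto simp: algebra_simps intro: order_trans)
        moreover have "2 * ln t \<le> \<eta> * h t"
          using X2[of t] k' t \<eta> by (simp add: field_simps)
        ultimately have "- h t \<le> - (1 - \<epsilon>) * h k + - (2 * ln t)"
          by (simp add: algebra_simps)
        then have "f (-t) \<le> exp (- (1 - \<epsilon>) * h k + - (2 * ln t))"
          using f_eq[of t] k' t by simp
        also have "\<dots> = exp (- (1 - \<epsilon>) * h k) * exp (- (2 * ln t))"
          by (rule exp_add)
        also have "exp (- (2 * ln t)) = 1 / t\<^sup>2"
          using k' t by (simp add: exp_minus exp_double ln_realpow[symmetric] inverse_eq_divide)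
        finally show ?thesis .
      qed
      then have "emeasure M {..-k} \<le> (\<integral>\<^sup>+ t. ennreal (exp (- (1 - \<epsilon>) * h k)) * (ennreal (1 / t\<^sup>2) * indicator {k..} t) \<partial>lborel)"
        unfolding emeasure_atMost_has_density[OF f]
        by (intro nn_integral_mono) (auto split: split_indicator simp: ennreal_mult[symmetric] simp del: mult_minus_left times_divide_eq_right)
      also have "\<dots> = ennreal (exp (- (1 - \<epsilon>) * h k)) * ennreal (1 / k)"
        using k' by (subst nn_integral_cmult) (auto simp: nn_integral_inverse_square_atLeast)
      also have "\<dots> = ennreal (exp (- (1 - \<epsilon>) * h k) * (1 / k))"
        using k' by (simp add: ennreal_mult[symmetric])
      finally have "cdf M (-k) \<le> exp (- (1 - \<epsilon>) * h k) * (1 / k)"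
        using k' by (simp add: cdf_def emeasure_eq_measure)
      also have "\<dots> \<le> exp (- (1 - \<epsilon>) * h k) * 1"
        using k' by (intro mult_left_mono) auto
      finally show ?thesis by simp
    qed
    then show ?thesis
      unfolding eventually_at_top_linorder by blast
  qed

  have lower: "\<forall>\<^sub>F k in at_top. cdf M (-k) \<ge> exp (- (1 + \<epsilon>) * h k)"
  proof -
    \<comment> \<open>A single \<open>\<delta>\<close> serves as Potter tolerance and as relative
      length of the interval; \<open>k \<ge> 1 / \<delta>\<close> later makes the absolute length
      \<open>\<delta> * k\<close> at least 1.\<close>
    have "((\<lambda>\<delta>. exp \<delta> * (1 + \<delta>) powr (\<alpha> + \<delta>)) \<longlongrightarrow> 1) (at_right 0)"
      by real_asymp
    then have "\<forall>\<^sub>F \<delta> in at_right 0. exp \<delta> * (1 + \<delta>) powr (\<alpha> + \<delta>) < 1 + \<epsilon>"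
      using \<epsilon> by (intro order_tendstoD) auto
    then have "\<forall>\<^sub>F \<delta> in at_right 0. exp \<delta> * (1 + \<delta>) powr (\<alpha> + \<delta>) < 1 + \<epsilon> \<and> \<delta> > 0"
      using eventually_at_right_less[of 0] by eventually_elim auto
    then obtain \<delta> where \<delta>: "exp \<delta> * (1 + \<delta>) powr (\<alpha> + \<delta>) < 1 + \<epsilon>" "\<delta> > 0"
      using eventually_happens'[OF trivial_limit_at_right_real] by blast
    obtain X1 where X1: "X1 > 0" "\<And>x y. x \<ge> X1 \<Longrightarrow> y \<ge> x \<Longrightarrow> h x > 0 \<and> h y \<le> exp \<delta> * (y / x) powr (\<alpha> + \<delta>) * h x"
      using regvar_Potter[OF hreg \<open>\<delta> > 0\<close>] by blast
    have "cdf M (-k) \<ge> exp (- (1 + \<epsilon>) * h k)" if k: "k \<ge> Max {X0, X1, 1 / \<delta>}" for k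
    proof -
      have k': "k \<ge> X0" "k \<ge> X1" "k \<ge> 1 / \<delta>" "k > 0"
        using k X1(1) by auto
      have "f (-t) \<ge> exp (- (1 + \<epsilon>) * h k)" if t: "k \<le> t" "t \<le> (1 + \<delta>) * k" for t
      proof -
        have "(t / k) powr (\<alpha> + \<delta>) \<le> (1 + \<delta>) powr (\<alpha> + \<delta>)"
          using t k' \<alpha> \<delta> by (intro powr_mono2) (auto simp: field_simps)
        then have "exp \<delta> * (t / k) powr (\<alpha> + \<delta>) \<le> exp \<delta> * (1 + \<delta>) powr (\<alpha> + \<delta>)"
          by (intro mult_left_mono) auto
        also note less_imp_le[OF \<delta>(1)]
        finally have "exp \<delta> * (t / k) powr (\<alpha> + \<delta>) \<le> 1 + \<epsilon>" .
        then have "exp \<delta> * (t / k) powr (\<alpha> + \<delta>) * h k \<le> (1 + \<epsilon>) * h k"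
          using X0[of k] k' by (intro mult_right_mono) auto
        moreover have "h t \<le> exp \<delta> * (t / k) powr (\<alpha> + \<delta>) * h k"
          using X1(2)[of k t] k' t by blast
        ultimately have "h t \<le> (1 + \<epsilon>) * h k"
          by linarith
        then show ?thesis
          using f_eq[of t] k' t by (simp add: algebra_simps)
      qed
      then have "(\<integral>\<^sup>+ t. ennreal (exp (- (1 + \<epsilon>) * h k)) * indicator {k..(1 + \<delta>) * k} t \<partial>lborel) \<le> emeasure M {..-k}"
        unfolding emeasure_atMost_has_density[OF f]
        by (intro nn_integral_mono) (auto split: split_indicator intro!: ennreal_leI simp del: mult_minus_left)
      moreover have "(\<integral>\<^sup>+ t. ennreal (exp (- (1 + \<epsilon>) * h k)) * indicator {k..(1 + \<delta>) * k} t \<partial>lborel)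
          = ennreal (exp (- (1 + \<epsilon>) * h k)) * ennreal (\<delta> * k)"
        using k' \<delta> by (subst nn_integral_cmult) (auto simp: algebra_simps)
      ultimately have "exp (- (1 + \<epsilon>) * h k) * (\<delta> * k) \<le> cdf M (-k)"
        using k' \<delta> by (simp add: cdf_def emeasure_eq_measure ennreal_mult[symmetric])
      moreover have "exp (- (1 + \<epsilon>) * h k) * 1 \<le> exp (- (1 + \<epsilon>) * h k) * (\<delta> * k)"
        using k' \<delta> by (intro mult_left_mono) (auto simp: field_simps)
      ultimately show ?thesis by linarith
    qed
    then show ?thesis
      unfolding eventually_at_top_linorder by blast
  qed

  from upper lower
  show "\<forall>\<^sub>F k in at_top. (1 - \<epsilon>) * - ln (f (-k)) \<le> - ln (cdf M (-k)) \<and>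
      - ln (cdf M (-k)) \<le> (1 + \<epsilon>) * - ln (f (-k))"
    unfolding h_def[symmetric]
  proof eventually_elim
    case (elim k)
    \<comment> \<open>Positivity must come from the lower bound: with \<open>ln 0 = 0\<close>, the
      upper bound cannot be passed through \<open>ln\<close> on its own.\<close>
    have pos: "cdf M (-k) > 0"
      using elim(2) exp_gt_zero order_less_le_trans by blast
    then have "ln (cdf M (-k)) \<le> ln (exp (- (1 - \<epsilon>) * h k))"
      using elim(1) by (subst ln_le_cancel_iff) (auto simp only: exp_gt_zero)
    moreover have "ln (exp (- (1 + \<epsilon>) * h k)) \<le> ln (cdf M (-k))"
      using pos elim(2) by (subst ln_le_cancel_iff) (auto simp only: exp_gt_zero)
    ultimately show ?case by (simp add: algebra_simps)
  qed
qed

section \<open>The Black--Scholes put price\<close>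

lemma psi_conv:
  assumes "x \<ge> 0"
  shows "psi x = 2 / (sqrt (x + 1) + sqrt x)\<^sup>2"
proof -
  \<comment> \<open>Completing the square gives \<open>psi x = 2 * (a - b)\<^sup>2\<close>, and
    \<open>(a - b) * (a + b) = 1\<close> moves the difference into the denominator. Without
    cancellation, sign, monotonicity and scaling can be read off.\<close>
  define a b where "a = sqrt (x + 1)" and "b = sqrt x"
  have sq: "a\<^sup>2 = x + 1" "b\<^sup>2 = x" and pos: "a > 0" "b \<ge> 0"
    using assms by (auto simp: a_def b_def)
  have "sqrt (x\<^sup>2 + x) = a * b"
    by (simp add: a_def b_def real_sqrt_mult [symmetric] power2_eq_square algebra_simps)
  then have "psi x = 2 * (a - b)\<^sup>2"
    using sq by (simp add: psi_def power2_diff)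
  moreover have "(a - b) * (a + b) = 1"
    using sq by (simp add: power2_eq_square algebra_simps)
  then have "a - b = 1 / (a + b)"
    using pos by (simp add: field_simps)
  ultimately have "psi x = 2 * (1 / (a + b))\<^sup>2"
    by (simp only:)
  then show ?thesis
    by (simp add: a_def b_def power_one_over)
qed

lemma psi_pos:
  assumes "x \<ge> 0"
  shows "psi x > 0"
proof -
  have "sqrt (x + 1) + sqrt x > 0"
    using assms by (intro add_pos_nonneg) auto
  then show ?thesis
    unfolding psi_conv[OF assms] by (intro divide_pos_pos zero_less_power) auto
qed

lemma psi_antimono: "0 \<le> x \<Longrightarrow> x \<le> y \<Longrightarrow> psi y \<le> psi x"
  by (subst (1 2) psi_conv)
     (auto intro!: divide_left_mono power_mono add_mono mult_pos_pos zero_less_power add_pos_nonneg)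

lemma psi_less_2: "x > 0 \<Longrightarrow> psi x < 2"
  by (simp add: psi_def power2_eq_square real_less_rsqrt)

text \<open>Since \<open>c \<ge> 1\<close>, both \<open>x + 1 \<le> c * (y + 1)\<close> and
  \<open>x \<le> c * y\<close> hold, and \<open>sqrt c\<close> factors out of the sum of roots: a
  relative error in the argument costs at most the same relative error in
  \<open>psi\<close>.\<close>

lemma psi_le_scaled:
  assumes "0 \<le> x" "0 < y" "x \<le> c * y" "c \<ge> 1"
  shows "psi y \<le> c * psi x"
proof -
  have "(sqrt (x + 1) + sqrt x)\<^sup>2 \<le> (sqrt (c * (y + 1)) + sqrt (c * y))\<^sup>2"
    using assms by (intro power_mono add_mono) (auto simp: algebra_simps)
  also have "\<dots> = (sqrt c * (sqrt (y + 1) + sqrt y))\<^sup>2"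
    by (simp only: real_sqrt_mult distrib_left[of "sqrt c"])
  also have "\<dots> = c * (sqrt (y + 1) + sqrt y)\<^sup>2"
    using assms by (simp add: power_mult_distrib)
  finally have *: "(sqrt (x + 1) + sqrt x)\<^sup>2 \<le> c * (sqrt (y + 1) + sqrt y)\<^sup>2" .
  have "sqrt (x + 1) + sqrt x > 0" "sqrt (y + 1) + sqrt y > 0"
    using assms by (auto intro!: add_pos_nonneg)
  then have "0 < (sqrt (x + 1) + sqrt x)\<^sup>2" "0 < (sqrt (y + 1) + sqrt y)\<^sup>2"
    by auto
  with * assms show ?thesis
    by (simp add: psi_conv divide_simps split: if_splits)
qed

text \<open>Scaling in both directions traps the ratio between \<open>1 / max 1 (f k / g k)\<close>
  and \<open>max 1 (g k / f k)\<close>. This covers arguments that converge, diverge or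
  oscillate.\<close>

lemma psi_asymp_equiv:
  assumes eq: "f \<sim>[F] g" and pos: "eventually (\<lambda>k. f k > 0) F" "eventually (\<lambda>k. g k > 0) F"
  shows "(\<lambda>k. psi (f k)) \<sim>[F] (\<lambda>k. psi (g k))"
proof (rule asymp_equivI', rule tendsto_sandwich)
  have lim: "((\<lambda>k. f k / g k) \<longlongrightarrow> 1) F"
    by (rule asymp_equivD_strong[OF eq eventually_mono[OF pos(1)]]) simp
  then have inv: "((\<lambda>k. g k / f k) \<longlongrightarrow> 1) F"
    using tendsto_inverse[OF lim] by simp
  show "eventually (\<lambda>k. psi (f k) / psi (g k) \<le> max 1 (g k / f k)) F"
    using pos
  proof eventually_elim
    case (elim k)
    have "psi (f k) \<le> max 1 (g k / f k) * psi (g k)"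
      using elim by (intro psi_le_scaled) (auto simp: field_simps max_def)
    then show ?case
      using elim psi_pos[of "g k"] by (simp add: field_simps)
  qed
  show "eventually (\<lambda>k. 1 / max 1 (f k / g k) \<le> psi (f k) / psi (g k)) F"
    using pos
  proof eventually_elim
    case (elim k)
    have "psi (g k) \<le> max 1 (f k / g k) * psi (f k)"
      using elim by (intro psi_le_scaled) (auto simp: field_simps max_def)
    then show ?case
      using elim psi_pos[of "g k"] by (simp add: field_simps)
  qed
  show "((\<lambda>k. max 1 (g k / f k)) \<longlongrightarrow> 1) F"
    using tendsto_max[OF tendsto_const inv, of 1] by simp
  show "((\<lambda>k. 1 / max 1 (f k / g k)) \<longlongrightarrow> 1) F"
    using tendsto_divide[OF tendsto_const tendsto_max[OF tendsto_const lim, of 1], of 1] by simp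
qed

lemma psi_asymp_equiv_at_top: "psi \<sim>[at_top] (\<lambda>x. 1 / (2 * x))"
proof (rule asymp_equivI')
  show "((\<lambda>x. psi x / (1 / (2 * x))) \<longlongrightarrow> 1) at_top"
    unfolding psi_def by real_asymp
qed

text \<open>This is \<open>(d1 (-k) \<sigma>)\<^sup>2 / (2 * k)\<close> at
  \<open>\<sigma>\<^sup>2 = k * v\<close>.\<close>

definition bs_rate :: "real \<Rightarrow> real" where
  "bs_rate v = 1 / (2 * v) + 1 / 2 + v / 8"

text \<open>With \<open>a\<close> and \<open>b\<close> the two roots, the outer terms of the rate
  are \<open>(a + b)\<^sup>2 / 4\<close> and \<open>(a - b)\<^sup>2 / 4\<close>, whose sum is
  \<open>(a\<^sup>2 + b\<^sup>2) / 2 = x + 1 / 2\<close>.\<close>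

lemma bs_rate_psi:
  assumes "x \<ge> 0"
  shows "bs_rate (psi x) = 1 + x"
proof -
  define a b where "a = sqrt (x + 1)" and "b = sqrt x"
  have sq: "a\<^sup>2 = x + 1" "b\<^sup>2 = x" and pos: "a > 0" "b \<ge> 0"
    using assms by (auto simp: a_def b_def)
  have "(a - b) * (a + b) = 1"
    using sq by (simp add: power2_eq_square algebra_simps)
  then have "1 / (a + b) = a - b"
    using pos by (simp add: field_simps)
  moreover have "psi x = 2 * (1 / (a + b))\<^sup>2"
    using psi_conv[OF assms] by (simp add: a_def b_def power_one_over)
  ultimately have psi: "psi x / 8 = (a - b)\<^sup>2 / 4"
    by simp
  have "1 / (2 * psi x) = (a + b)\<^sup>2 / 4"
    using psi_conv[OF assms] pos by (simp add: a_def b_def)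
  with psi show ?thesis
    using sq by (simp add: bs_rate_def power2_sum power2_diff field_simps)
qed

text \<open>The factored form shows the sign of the difference, as \<open>u * v \<le> 4\<close> on
  \<open>(0, 2]\<close>, and measures the rate gaps in the price bracket.\<close>

lemma bs_rate_diff:
  assumes "u > 0" "v > 0"
  shows "bs_rate u - bs_rate v = (v - u) * (1 / (2 * u * v) - 1 / 8)"
  using assms by (simp add: bs_rate_def field_simps)

lemma bs_rate_antimono:
  assumes "0 < u" "u \<le> v" "v \<le> 2"
  shows "bs_rate v \<le> bs_rate u"
proof -
  have "u * v \<le> 2 * 2"
    using assms by (intro mult_mono) auto
  then have "1 / (2 * u * v) - 1 / 8 \<ge> 0"
    using assms by (simp add: field_simps)
  then have "(v - u) * (1 / (2 * u * v) - 1 / 8) \<ge> 0"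
    using assms by (intro mult_nonneg_nonneg) auto
  then show ?thesis
    using bs_rate_diff[of u v] assms by simp
qed

section \<open>The normal distribution function and the vega\<close>

lemma Phi_eq_cdf: "Phi x = cdf (density lborel (\<lambda>x. ennreal (std_normal_density x))) x"
proof -
  have "emeasure (density lborel (\<lambda>x. ennreal (std_normal_density x))) {..x}
      = (\<integral>\<^sup>+ t. ennreal (indicator {..x} t * std_normal_density t) \<partial>lborel)"
    by (auto simp: emeasure_density intro!: nn_integral_cong split: split_indicator)
  also have "\<dots> = ennreal (Phi x)"
    unfolding Phi_def set_lebesgue_integral_def using integrable_normal_density
    by (subst nn_integral_eq_integral) (auto intro: integrable_mult_indicator[where 'b = real, simplified])
  finally show ?thesis
    by (simp add: cdf_def measure_def Phi_def set_lebesgue_integral_def integral_nonneg_AE)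
qed

lemma real_distribution_std_normal:
  "real_distribution (density lborel (\<lambda>x. ennreal (std_normal_density x)))"
  using prob_space_normal_density[of 1 0]
  by (simp add: real_distribution_def real_distribution_axioms_def)

lemma Phi_at_bot: "(Phi \<longlongrightarrow> 0) at_bot"
proof -
  interpret real_distribution "density lborel (\<lambda>x. ennreal (std_normal_density x))"
    by (rule real_distribution_std_normal)
  show ?thesis
    using cdf_lim_at_bot by (simp add: Phi_eq_cdf[abs_def])
qed

lemma Phi_has_real_derivative [derivative_intros]:
  assumes "(g has_real_derivative g') (at x)"
  shows "((\<lambda>x. Phi (g x)) has_real_derivative (std_normal_density (g x) * g')) (at x)"
proof -
  have Phi: "(Phi has_real_derivative std_normal_density x) (at x)" for x
  proof -
    \<comment> \<open>Splitting off the constant \<open>Phi a\<close> reduces the claim to the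
      fundamental theorem of calculus on a compact interval with \<open>x\<close> in its
      interior.\<close>
    define a b where "a = x - 1" and "b = x + 1"
    have eq: "Phi y = Phi a + integral {a..y} std_normal_density" if "y \<in> {a..b}" for y
    proof -
      have ay: "set_integrable lborel A std_normal_density" if "A \<in> sets borel" for A
        unfolding set_integrable_def using integrable_normal_density that
        by (intro integrable_mult_indicator) auto
      have "Phi y = (LINT t:{..a} \<union> {a<..y}|lborel. std_normal_density t)"
        using that by (simp add: Phi_def ivl_disj_un)
      also have "\<dots> = Phi a + (LINT t:{a<..y}|lborel. std_normal_density t)"
        unfolding Phi_def using ay by (intro set_integral_Un) auto
      also have "(LINT t:{a<..y}|lborel. std_normal_density t) = (LINT t:{a..y}|lborel. std_normal_density t)"
        using AE_lborel_singleton[of a]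
        by (intro set_integral_cong_set) (auto simp: set_borel_measurable_def elim!: eventually_mono)
      also have "\<dots> = integral {a..y} std_normal_density"
        using ay by (intro set_borel_integral_eq_integral) auto
      finally show ?thesis .
    qed
    have "((\<lambda>y. integral {a..y} std_normal_density) has_real_derivative std_normal_density x) (at x within {a..b})"
      unfolding normal_density_def
      by (intro integral_has_real_derivative continuous_intros) (auto simp: a_def b_def)
    then have "((\<lambda>y. integral {a..y} std_normal_density) has_real_derivative std_normal_density x) (at x)"
      by (subst (asm) at_within_interior) (auto simp: a_def b_def)
    then have "((\<lambda>y. Phi a + integral {a..y} std_normal_density) has_real_derivative std_normal_density x) (at x)"
      by (auto intro!: derivative_eq_intros)
    then show ?thesis
    proof (rule has_field_derivative_transform_within_open)
      show "open {a<..<b}" "x \<in> {a<..<b}"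
        by (auto simp: a_def b_def)
    qed (simp add: eq [symmetric])
  qed
  show ?thesis
    using DERIV_chain2[OF Phi assms] .
qed

text \<open>As \<open>d1 - d2 = \<sigma>\<close> and \<open>d1 + d2 = -2 * x / \<sigma>\<close>, the
  squares differ by \<open>-2 * x\<close>. Through this identity the terms in
  \<open>x / \<sigma>\<^sup>2\<close> cancel in the derivative of the price.\<close>

lemma exp_mult_density_d2:
  assumes "\<sigma> \<noteq> 0"
  shows "exp x * std_normal_density (d2 x \<sigma>) = std_normal_density (d1 x \<sigma>)"
proof -
  have "x + - (d2 x \<sigma>)\<^sup>2 / 2 = - (d1 x \<sigma>)\<^sup>2 / 2"
    using assms by (simp add: d1_def d2_def power2_eq_square field_simps)
  then show ?thesis
    by (simp add: std_normal_density_def exp_add [symmetric])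
qed

lemma p_BS_has_real_derivative:
  assumes "\<sigma> > 0"
  shows "(p_BS x has_real_derivative std_normal_density (d1 x \<sigma>)) (at \<sigma>)"
proof -
  have sym: "std_normal_density (- y) = std_normal_density y" for y
    by (simp add: std_normal_density_def)
  have "((\<lambda>\<sigma>. exp x * Phi (- d2 x \<sigma>) - Phi (- d1 x \<sigma>)) has_real_derivative
     (exp x * (std_normal_density (- d2 x \<sigma>) * (- (x / \<sigma>\<^sup>2) + 1 / 2))
      - std_normal_density (- d1 x \<sigma>) * (- (x / \<sigma>\<^sup>2) - 1 / 2))) (at \<sigma>)"
    unfolding d1_def d2_def using assms
    by (auto intro!: derivative_eq_intros simp: power2_eq_square)
  moreover have "exp x * (std_normal_density (- d2 x \<sigma>) * (- (x / \<sigma>\<^sup>2) + 1 / 2))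
      - std_normal_density (- d1 x \<sigma>) * (- (x / \<sigma>\<^sup>2) - 1 / 2) = std_normal_density (d1 x \<sigma>)"
    using assms exp_mult_density_d2[of \<sigma> x]
    by (simp add: sym mult.assoc [symmetric] algebra_simps)
  ultimately show ?thesis
    by (simp add: p_BS_def[abs_def])
qed

lemma p_BS_strict_mono:
  assumes "0 < \<sigma>" "\<sigma> < \<tau>"
  shows "p_BS x \<sigma> < p_BS x \<tau>"
proof (rule DERIV_pos_imp_increasing[OF assms(2)])
  fix s assume "\<sigma> \<le> s"
  then show "\<exists>y. DERIV (p_BS x) s :> y \<and> 0 < y"
    using assms p_BS_has_real_derivative[of s x] normal_density_pos[of 1 0]
    by (metis order_less_le_trans zero_less_one)
qed

text \<open>At a negative log-strike both \<open>- d1\<close> and \<open>- d2\<close> tend to minus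
  infinity. This is the initial value from which price increments in \<open>\<sigma>\<close> are
  accumulated.\<close>

lemma p_BS_at_right_0:
  assumes "k > 0"
  shows "(p_BS (-k) \<longlongrightarrow> 0) (at_right 0)"
proof -
  have "filterlim (\<lambda>s. - d2 (-k) s) at_bot (at_right 0)" "filterlim (\<lambda>s. - d1 (-k) s) at_bot (at_right 0)"
    unfolding d1_def d2_def using assms by real_asymp+
  then have "((\<lambda>s. exp (-k) * Phi (- d2 (-k) s) - Phi (- d1 (-k) s)) \<longlongrightarrow> exp (-k) * 0 - 0) (at_right 0)"
    by (intro tendsto_intros filterlim_compose[OF Phi_at_bot])
  then show ?thesis
    by (simp add: p_BS_def[abs_def])
qed

lemma p_BS_nonneg:
  assumes "k > 0" "\<sigma> > 0"
  shows "p_BS (-k) \<sigma> \<ge> 0"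
proof (rule tendsto_upperbound[OF p_BS_at_right_0])
  have "eventually (\<lambda>s. 0 < s \<and> s < \<sigma>) (at_right 0)"
    using assms by (auto simp: eventually_at_right_field)
  then show "eventually (\<lambda>s. p_BS (-k) s \<le> p_BS (-k) \<sigma>) (at_right 0)"
    by eventually_elim (auto intro!: less_imp_le p_BS_strict_mono)
qed (use assms in auto)

lemma std_normal_density_d1:
  assumes "k > 0" "\<sigma> > 0"
  shows "std_normal_density (d1 (-k) \<sigma>) = exp (- k * bs_rate (\<sigma>\<^sup>2 / k)) / sqrt (2 * pi)"
proof -
  have "- (d1 (-k) \<sigma>)\<^sup>2 / 2 = - k * bs_rate (\<sigma>\<^sup>2 / k)"
    using assms by (simp add: d1_def bs_rate_def power2_eq_square field_simps)
  then show ?thesis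
    by (simp add: std_normal_density_def)
qed

text \<open>By the mean value theorem the increment is \<open>\<tau> - \<sigma>\<close> times the
  vega at an intermediate volatility. The bound 2 keeps the variance ratio where the rate decreases,
  so the vega lies between its values at the endpoints.\<close>

lemma p_BS_diff_bounds:
  assumes k: "k > 0" and "0 < \<sigma>" "\<sigma> < \<tau>" and "\<tau>\<^sup>2 / k \<le> 2"
  shows "p_BS (-k) \<tau> - p_BS (-k) \<sigma> \<le> (\<tau> - \<sigma>) * exp (- k * bs_rate (\<tau>\<^sup>2 / k)) / sqrt (2 * pi)"
    and "p_BS (-k) \<tau> - p_BS (-k) \<sigma> \<ge> (\<tau> - \<sigma>) * exp (- k * bs_rate (\<sigma>\<^sup>2 / k)) / sqrt (2 * pi)"
proof -
  have "\<exists>z. \<sigma> < z \<and> z < \<tau> \<and>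
      p_BS (-k) \<tau> - p_BS (-k) \<sigma> = (\<tau> - \<sigma>) * std_normal_density (d1 (-k) z)"
    by (rule MVT2[OF \<open>\<sigma> < \<tau>\<close>]) (use assms in \<open>auto intro: p_BS_has_real_derivative\<close>)
  then obtain z where z: "\<sigma> < z" "z < \<tau>"
    "p_BS (-k) \<tau> - p_BS (-k) \<sigma> = (\<tau> - \<sigma>) * std_normal_density (d1 (-k) z)"
    by blast
  have "\<sigma>\<^sup>2 / k \<le> z\<^sup>2 / k" "z\<^sup>2 / k \<le> \<tau>\<^sup>2 / k" "0 < \<sigma>\<^sup>2 / k"
    using z assms by (auto intro!: divide_right_mono power_mono)
  then have "bs_rate (\<tau>\<^sup>2 / k) \<le> bs_rate (z\<^sup>2 / k)" "bs_rate (z\<^sup>2 / k) \<le> bs_rate (\<sigma>\<^sup>2 / k)"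
    using assms(4) by (auto intro!: bs_rate_antimono)
  then show "p_BS (-k) \<tau> - p_BS (-k) \<sigma> \<le> (\<tau> - \<sigma>) * exp (- k * bs_rate (\<tau>\<^sup>2 / k)) / sqrt (2 * pi)"
    and "p_BS (-k) \<tau> - p_BS (-k) \<sigma> \<ge> (\<tau> - \<sigma>) * exp (- k * bs_rate (\<sigma>\<^sup>2 / k)) / sqrt (2 * pi)"
    using z assms unfolding z(3) by (auto simp: std_normal_density_d1 intro!: divide_right_mono mult_left_mono)
qed

text \<open>Limit of the upper increment bound as the smaller volatility tends to 0, where the price
  vanishes.\<close>

lemma p_BS_upper_bound:
  assumes k: "k > 0" and "0 < \<tau>" and "\<tau>\<^sup>2 / k \<le> 2"
  shows "p_BS (-k) \<tau> \<le> \<tau> * exp (- k * bs_rate (\<tau>\<^sup>2 / k)) / sqrt (2 * pi)"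
proof -
  have "((\<lambda>s. p_BS (-k) \<tau> - p_BS (-k) s) \<longlongrightarrow> p_BS (-k) \<tau> - 0) (at_right 0)"
    using p_BS_at_right_0[OF k] by (intro tendsto_intros)
  moreover have "((\<lambda>s. (\<tau> - s) * exp (- k * bs_rate (\<tau>\<^sup>2 / k)) / sqrt (2 * pi)) \<longlongrightarrow>
      (\<tau> - 0) * exp (- k * bs_rate (\<tau>\<^sup>2 / k)) / sqrt (2 * pi)) (at_right 0)"
    by (intro tendsto_intros) auto
  moreover have "eventually (\<lambda>s. 0 < s \<and> s < \<tau>) (at_right 0)"
    using assms by (auto simp: eventually_at_right_field)
  then have "eventually (\<lambda>s. p_BS (-k) \<tau> - p_BS (-k) s \<le>
      (\<tau> - s) * exp (- k * bs_rate (\<tau>\<^sup>2 / k)) / sqrt (2 * pi)) (at_right 0)"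
    by eventually_elim (use assms p_BS_diff_bounds(1) in auto)
  ultimately show ?thesis
    using tendsto_le[OF trivial_limit_at_right_real] by fastforce
qed

text \<open>The target exponent \<open>k * (1 + x)\<close> is \<open>k * bs_rate (psi x)\<close>.
  Moving \<open>v\<close> off \<open>psi x\<close> by a factor \<open>1 - \<delta>\<close> or
  \<open>1 + \<delta>\<close> changes the rate by an amount bounded below in terms of
  \<open>a\<close> and \<open>\<delta>\<close> alone, which beats the algebraic prefactors uniformly
  in \<open>x\<close>, even when \<open>psi x\<close> is tiny.\<close>

lemma p_BS_bracket:
  assumes a: "a > 0" and \<delta>: "0 < \<delta>" "\<delta> < 1" and le2: "(1 + \<delta>) * psi a \<le> 2"
  shows "\<forall>\<^sub>F k in at_top. \<forall>x\<ge>a.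
      p_BS (-k) (sqrt (k * ((1 - \<delta>) * psi x))) < exp (- k * (1 + x)) \<and>
      exp (- k * (1 + x)) < p_BS (-k) (sqrt (k * ((1 + \<delta>) * psi x)))"
proof -
  \<comment> \<open>\<open>c1\<close> bounds the rate gap between
    \<open>(1 - \<delta>) * psi x\<close> and \<open>psi x\<close>; \<open>c2 / psi x\<close> bounds
    the gap between \<open>psi x\<close> and \<open>(1 + \<delta> / 2) * psi x\<close>;
    \<open>c3\<close> is the length of the volatility interval between the factors
    \<open>1 + \<delta> / 2\<close> and \<open>1 + \<delta>\<close>, relative to
    \<open>sqrt (k * psi x)\<close>.\<close>
  define c1 where "c1 = \<delta> * (4 - (psi a)\<^sup>2) / 16"
  define c2 where "c2 = \<delta> / 2 * (1 / (2 * (1 + \<delta> / 2)) - (psi a)\<^sup>2 / 8)"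
  define c3 where "c3 = sqrt (1 + \<delta>) - sqrt (1 + \<delta> / 2)"
  have \<psi>a: "0 < psi a" "psi a < 2"
    using a psi_pos[of a] psi_less_2[of a] by auto
  have "(psi a)\<^sup>2 < 2\<^sup>2"
    using \<psi>a by (intro power_strict_mono) auto
  then have "c1 > 0"
    using \<delta> by (simp add: c1_def)
  have "(psi a)\<^sup>2 * (1 + \<delta> / 2) < 4"
  proof -
    have "(1 + \<delta> / 2) * psi a < (1 + \<delta>) * psi a"
      using \<delta> \<psi>a by (intro mult_strict_right_mono) auto
    also note le2
    finally have "psi a * ((1 + \<delta> / 2) * psi a) < 2 * 2"
      using \<psi>a \<delta> by (intro mult_strict_mono) auto
    then show ?thesis
      by (simp add: power2_eq_square algebra_simps)
  qed
  then have "(psi a)\<^sup>2 / 8 < 1 / (2 * (1 + \<delta> / 2))"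
    using \<delta> by (simp add: field_simps)
  then have "c2 > 0"
    unfolding c2_def using \<delta> by (intro mult_pos_pos) auto
  have "c3 > 0"
    using \<delta> by (simp add: c3_def)
  have "\<forall>\<^sub>F k in at_top. sqrt (2 * k) * exp (- k * c1) < sqrt (2 * pi)"
  proof (rule order_tendstoD)
    show "((\<lambda>k. sqrt (2 * k) * exp (- k * c1)) \<longlongrightarrow> 0) at_top"
      using \<open>c1 > 0\<close> by real_asymp
  qed simp
  moreover have "filterlim (\<lambda>k. sqrt (k / 2) * (k * (c2 * c3))) at_top at_top"
    using mult_pos_pos[OF \<open>c2 > 0\<close> \<open>c3 > 0\<close>] by real_asymp
  then have "\<forall>\<^sub>F k in at_top. sqrt (k / 2) * (k * (c2 * c3)) > sqrt (2 * pi)"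
    by (simp add: filterlim_at_top_dense)
  ultimately show ?thesis
    using eventually_gt_at_top[of 0]
  proof eventually_elim
    case (elim k)
    note k = \<open>0 < k\<close>
    show ?case
    proof (intro allI impI)
      fix x assume x: "x \<ge> a"
      define \<psi> where "\<psi> = psi x"
      have \<psi>: "0 < \<psi>" "\<psi> \<le> psi a" "\<psi> < 2" "\<psi>\<^sup>2 \<le> (psi a)\<^sup>2"
        using x a \<psi>a psi_pos[of x] psi_antimono[of a x] by (auto simp: \<psi>_def intro!: power_mono)
      have rate: "bs_rate \<psi> = 1 + x"
        using x a by (simp add: \<psi>_def bs_rate_psi)

      define w where "w = (1 - \<delta>) * \<psi>"
      have w: "0 < w" "w \<le> 2"
        using \<delta> \<psi> mult_mono[of "1 - \<delta>" 1 \<psi> 2] by (auto simp: w_def)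
      have "c1 \<le> \<delta> * (4 - \<psi>\<^sup>2) / 16"
        using \<delta> \<psi> by (auto simp: c1_def)
      also have "\<dots> \<le> \<delta> * (4 - \<psi>\<^sup>2) / (8 * \<psi>)"
        using \<psi> \<delta> power_strict_mono[of \<psi> 2 2] by (intro divide_left_mono mult_nonneg_nonneg) auto
      also have "\<dots> = \<delta> * \<psi> * (1 / (2 * \<psi>\<^sup>2) - 1 / 8)"
        using \<psi> by (simp add: field_simps power2_eq_square)
      also have "\<dots> \<le> \<delta> * \<psi> * (1 / (2 * w * \<psi>) - 1 / 8)"
        using \<psi> \<delta> w
        by (intro mult_left_mono diff_right_mono divide_left_mono)
           (auto simp: w_def power2_eq_square mult_le_cancel_right1 intro!: mult_pos_pos mult_right_mono)
      also have "\<dots> = bs_rate w - bs_rate \<psi>"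
        using bs_rate_diff[of w \<psi>] w \<psi> by (simp add: w_def algebra_simps)
      finally have "k * c1 \<le> k * (bs_rate w - bs_rate \<psi>)"
        using k by (intro mult_left_mono) auto
      then have exp_le: "exp (- k * bs_rate w) \<le> exp (- k * c1) * exp (- k * (1 + x))"
        unfolding exp_add [symmetric] rate by (simp add: algebra_simps)
      have "p_BS (-k) (sqrt (k * w)) \<le> sqrt (k * w) * exp (- k * bs_rate w) / sqrt (2 * pi)"
        using p_BS_upper_bound[of k "sqrt (k * w)"] k w by simp
      also have "\<dots> \<le> sqrt (2 * k) * (exp (- k * c1) * exp (- k * (1 + x))) / sqrt (2 * pi)"
        using k w exp_le by (intro divide_right_mono mult_mono) auto
      also have "\<dots> = sqrt (2 * k) * exp (- k * c1) / sqrt (2 * pi) * exp (- k * (1 + x))"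
        by simp
      also have "\<dots> < 1 * exp (- k * (1 + x))"
        using elim by (intro mult_strict_right_mono) (auto simp: divide_less_eq)
      finally have upper: "p_BS (-k) (sqrt (k * w)) < exp (- k * (1 + x))"
        by simp

      \<comment> \<open>The price at \<open>v\<close> is bounded below by its increment from
        \<open>u\<close>. Starting at \<open>u\<close> and not at \<open>\<psi>\<close> keeps the
        rate on the whole interval strictly below the target \<open>1 + x\<close>.\<close>
      define u v where "u = (1 + \<delta> / 2) * \<psi>" and "v = (1 + \<delta>) * \<psi>"
      have uv: "\<psi> < u" "u < v"
        using \<delta> \<psi> by (auto simp: u_def v_def)
      have "v \<le> (1 + \<delta>) * psi a"
        unfolding v_def using \<delta> \<psi> by (intro mult_left_mono) auto
      then have "v \<le> 2"
        using le2 by simp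
      have "c2 / \<psi> \<le> \<delta> / 2 * (1 / (2 * (1 + \<delta> / 2)) - \<psi>\<^sup>2 / 8) / \<psi>"
        unfolding c2_def using \<delta> \<psi> by (intro divide_right_mono mult_left_mono) auto
      also have "\<dots> = (u - \<psi>) * (1 / (2 * \<psi> * u) - 1 / 8)"
        using \<delta> \<psi> by (simp add: u_def divide_simps power2_eq_square) (simp add: algebra_simps)
      also have "\<dots> = bs_rate \<psi> - bs_rate u"
        using bs_rate_diff[of \<psi> u] uv \<psi> by simp
      finally have "k * (c2 / \<psi>) \<le> k * (bs_rate \<psi> - bs_rate u)"
        using k by (intro mult_left_mono) auto
      \<comment> \<open>The crude bound \<open>y \<le> exp y\<close> is enough: with the interval
        length \<open>sqrt (k * \<psi>) * c3\<close>, the prefactor is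
        \<open>k * sqrt (k / \<psi>) * c2 * c3\<close>, and \<open>\<psi> \<le> 2\<close> bounds it
        below by a divergent function of \<open>k\<close> alone.\<close>
      also have "\<dots> \<le> exp (k * (bs_rate \<psi> - bs_rate u))"
        using exp_ge_add_one_self[of "k * (bs_rate \<psi> - bs_rate u)"] by linarith
      finally have "k * (c2 / \<psi>) * exp (- k * (1 + x)) \<le>
          exp (k * (bs_rate \<psi> - bs_rate u)) * exp (- k * (1 + x))"
        by (intro mult_right_mono) auto
      then have exp_ge: "k * (c2 / \<psi>) * exp (- k * (1 + x)) \<le> exp (- k * bs_rate u)"
        unfolding exp_add [symmetric] rate by (simp add: algebra_simps)
      have sqrt_diff: "sqrt (k * v) - sqrt (k * u) = sqrt (k * \<psi>) * c3"
        unfolding u_def v_def c3_def real_sqrt_mult by (simp add: right_diff_distrib mult_ac)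
      have "sqrt (k / 2) \<le> sqrt (k / \<psi>)"
        using k \<psi> by (intro real_sqrt_le_mono divide_left_mono) auto
      also have "\<dots> = sqrt (k * \<psi>) / \<psi>"
        using \<psi> by (simp add: real_sqrt_mult real_sqrt_divide field_simps)
      finally have "sqrt (k / 2) * (k * (c2 * c3)) \<le> sqrt (k * \<psi>) / \<psi> * (k * (c2 * c3))"
        using k \<open>c2 > 0\<close> \<open>c3 > 0\<close> by (intro mult_right_mono) auto
      with elim have "sqrt (2 * pi) < sqrt (k * \<psi>) / \<psi> * (k * (c2 * c3))"
        by simp
      then have "1 < sqrt (k * \<psi>) / \<psi> * (k * (c2 * c3)) / sqrt (2 * pi)"
        by (subst less_divide_eq) auto
      then have "1 * exp (- k * (1 + x)) < sqrt (k * \<psi>) / \<psi> * (k * (c2 * c3)) / sqrt (2 * pi) * exp (- k * (1 + x))"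
        by (intro mult_strict_right_mono) auto
      also have "\<dots> = (sqrt (k * v) - sqrt (k * u)) * (k * (c2 / \<psi>) * exp (- k * (1 + x))) / sqrt (2 * pi)"
        by (simp add: sqrt_diff)
      also have "\<dots> \<le> (sqrt (k * v) - sqrt (k * u)) * exp (- k * bs_rate u) / sqrt (2 * pi)"
        using exp_ge uv k by (intro divide_right_mono mult_left_mono) auto
      also have "\<dots> \<le> p_BS (-k) (sqrt (k * v)) - p_BS (-k) (sqrt (k * u))"
        using p_BS_diff_bounds(2)[of k "sqrt (k * u)" "sqrt (k * v)"] k uv \<psi> \<open>v \<le> 2\<close> by simp
      also have "\<dots> \<le> p_BS (-k) (sqrt (k * v))"
        using p_BS_nonneg[of k "sqrt (k * u)"] k uv \<psi> by simp
      finally have "exp (- k * (1 + x)) < p_BS (-k) (sqrt (k * v))"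
        by simp
      with upper show "p_BS (-k) (sqrt (k * ((1 - \<delta>) * psi x))) < exp (- k * (1 + x)) \<and>
          exp (- k * (1 + x)) < p_BS (-k) (sqrt (k * ((1 + \<delta>) * psi x)))"
        by (simp add: w_def v_def \<psi>_def)
    qed
  qed
qed

section \<open>From price brackets to implied volatility\<close>

lemma impvol_between:
  assumes "0 < s" "s < t" "p_BS x s < put_price M x" "put_price M x < p_BS x t"
  shows "s < impvol M x \<and> impvol M x < t"
proof -
  \<comment> \<open>The definite description in \<open>impvol\<close> needs a solution to exist: the
    bracket supplies one by continuity, and strict monotonicity makes it the only positive
    one.\<close>
  have "\<exists>\<sigma>. s \<le> \<sigma> \<and> \<sigma> \<le> t \<and> p_BS x \<sigma> = put_price M x"
    using assms by (intro IVT) (auto intro!: DERIV_isCont p_BS_has_real_derivative)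
  then obtain \<sigma> where \<sigma>: "s \<le> \<sigma>" "\<sigma> \<le> t" "p_BS x \<sigma> = put_price M x"
    by blast
  have "impvol M x = \<sigma>"
    unfolding impvol_def
  proof (rule the_equality)
    fix \<tau> assume "\<tau> > 0 \<and> p_BS x \<tau> = put_price M x"
    then show "\<tau> = \<sigma>"
      using \<sigma> assms p_BS_strict_mono[of \<tau> \<sigma> x] p_BS_strict_mono[of \<sigma> \<tau> x]
      by (cases \<tau> \<sigma> rule: linorder_cases) auto
  qed (use \<sigma> assms in auto)
  moreover have "\<sigma> \<noteq> s" "\<sigma> \<noteq> t"
    using \<sigma> assms by auto
  ultimately show ?thesis
    using \<sigma> by auto
qed

text \<open>With the put price written as \<open>exp (- k * (1 + x))\<close>, the bracket confines
  the implied variance ratio to within factors \<open>1 - \<delta>\<close> and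
  \<open>1 + \<delta>\<close> of \<open>psi x\<close>. Here \<open>x\<close> varies with
  \<open>k\<close>, so uniformity over \<open>x \<ge> a\<close> is essential.\<close>

lemma impvol_asymp_equiv:
  assumes a: "a > 0"
    and pos: "\<forall>\<^sub>F k in at_top. put_price M (-k) > 0"
    and ge: "\<forall>\<^sub>F k in at_top. -1 - ln (put_price M (-k)) / k \<ge> a"
  shows "(\<lambda>k. (impvol M (-k))\<^sup>2 / k) \<sim>[at_top] (\<lambda>k. psi (-1 - ln (put_price M (-k)) / k))"
proof (rule asymp_equivI', rule tendstoI)
  fix e :: real assume "e > 0"
  have \<psi>a: "0 < psi a" "psi a < 2"
    using a psi_pos[of a] psi_less_2[of a] by auto
  \<comment> \<open>The three bounds give the tolerance \<open>e\<close>, the condition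
    \<open>\<delta> < 1\<close>, and \<open>(1 + \<delta>) * psi a \<le> 2\<close>.\<close>
  define \<delta> where "\<delta> = min (min e (1 / 2)) (2 / psi a - 1)"
  have \<delta>: "0 < \<delta>" "\<delta> < 1" "\<delta> \<le> e"
    using \<open>e > 0\<close> \<psi>a by (auto simp: \<delta>_def)
  have "(1 + \<delta>) * psi a \<le> (2 / psi a) * psi a"
    using \<psi>a by (intro mult_right_mono) (auto simp: \<delta>_def)
  then have "(1 + \<delta>) * psi a \<le> 2"
    using \<psi>a by simp
  from p_BS_bracket[OF a \<delta>(1,2) this] pos ge eventually_gt_at_top[of 0]
  show "\<forall>\<^sub>F k in at_top.
      dist ((impvol M (-k))\<^sup>2 / k / psi (-1 - ln (put_price M (-k)) / k)) 1 < e"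
  proof eventually_elim
    case (elim k)
    define x where "x = -1 - ln (put_price M (-k)) / k"
    have "put_price M (-k) = exp (- k * (1 + x))"
      using elim by (simp add: x_def)
    moreover have x: "x \<ge> a" "psi x > 0"
      using elim a psi_pos[of x] by (auto simp: x_def)
    moreover have "p_BS (-k) (sqrt (k * ((1 - \<delta>) * psi x))) < exp (- k * (1 + x))"
      "exp (- k * (1 + x)) < p_BS (-k) (sqrt (k * ((1 + \<delta>) * psi x)))"
      using elim(1) x by auto
    ultimately have V: "sqrt (k * ((1 - \<delta>) * psi x)) < impvol M (-k)"
      "impvol M (-k) < sqrt (k * ((1 + \<delta>) * psi x))"
      using impvol_between[of "sqrt (k * ((1 - \<delta>) * psi x))" "sqrt (k * ((1 + \<delta>) * psi x))" "-k" M] elim \<delta>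
      by auto
    have nonneg: "0 \<le> k * ((1 - \<delta>) * psi x)" "0 \<le> k * ((1 + \<delta>) * psi x)"
      using elim \<delta> x by auto
    have "(sqrt (k * ((1 - \<delta>) * psi x)))\<^sup>2 < (impvol M (-k))\<^sup>2"
      using V nonneg by (intro power_strict_mono) auto
    moreover have "(impvol M (-k))\<^sup>2 < (sqrt (k * ((1 + \<delta>) * psi x)))\<^sup>2"
      using V nonneg real_sqrt_ge_zero[OF nonneg(1)] by (intro power_strict_mono) linarith+
    ultimately have "k * ((1 - \<delta>) * psi x) < (impvol M (-k))\<^sup>2"
      "(impvol M (-k))\<^sup>2 < k * ((1 + \<delta>) * psi x)"
      using nonneg by auto
    then have "1 - \<delta> < (impvol M (-k))\<^sup>2 / k / psi x" "(impvol M (-k))\<^sup>2 / k / psi x < 1 + \<delta>"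
      using elim x by (simp_all add: field_simps)
    then show ?case
      using \<delta>(3) by (simp add: dist_real_def x_def abs_less_iff)
  qed
qed

section \<open>Put prices and distribution functions\<close>

text \<open>In this form the payoff is visibly monotone in the strike and can be compared pointwise
  with multiples of indicators.\<close>

lemma put_price_eq: "put_price M x = (LINT y|M. max 0 (exp x - exp y))"
  unfolding put_price_def set_lebesgue_integral_def
  by (intro Bochner_Integration.integral_cong) (auto split: split_indicator)

context
  fixes M :: "real measure"
  assumes prob: "prob_space M" and sets [measurable_cong, simp]: "sets M = sets borel"
begin

interpretation prob_space M by (rule prob)

lemma integrable_put_payoff: "integrable M (\<lambda>y. max 0 (exp x - exp y))"
  by (rule integrable_const_bound[where B = "exp x"]) auto

lemma mono_put_price: "mono (put_price M)"
  unfolding put_price_eq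
  by (intro monoI integral_mono integrable_put_payoff max.mono) auto

lemma mono_cdf: "mono (cdf M)"
  by (auto intro!: monoI finite_measure_mono simp: cdf_def)

lemma cdf_eq_integral: "cdf M x = (LINT y|M. indicator {..x} y)"
  by (simp add: cdf_def)

lemma integrable_indicator_atMost: "integrable M (indicat_real {..x})"
  by (rule integrable_const_bound[where B = 1]) auto

lemma put_price_le: "put_price M x \<le> exp x * cdf M x"
proof -
  have "put_price M x \<le> (LINT y|M. exp x * indicator {..x} y)"
    unfolding put_price_eq
    by (intro integral_mono integrable_put_payoff integrable_mult_right integrable_indicator_atMost)
       (auto split: split_indicator)
  then show ?thesis
    by (simp add: cdf_eq_integral)
qed

lemma put_price_ge:
  assumes "y \<le> x"
  shows "(exp x - exp y) * cdf M y \<le> put_price M x"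
proof -
  have "(LINT t|M. (exp x - exp y) * indicator {..y} t) \<le> put_price M x"
    unfolding put_price_eq
    by (intro integral_mono integrable_put_payoff integrable_mult_right integrable_indicator_atMost)
       (auto split: split_indicator intro: max.coboundedI2)
  then show ?thesis
    by (simp add: cdf_eq_integral)
qed

text \<open>Markov's inequality in exponential form: \<open>exp (\<epsilon> * (x - y))\<close>
  dominates the indicator of \<open>y \<le> x\<close>.\<close>

lemma cdf_le_exp_moment:
  assumes int: "integrable M (\<lambda>x. exp (- \<epsilon> * x))" and "\<epsilon> > 0"
  shows "cdf M x \<le> exp (\<epsilon> * x) * (LINT x|M. exp (- \<epsilon> * x))"
proof -
  have "cdf M x \<le> (LINT y|M. exp (\<epsilon> * x) * exp (- \<epsilon> * y))"
    unfolding cdf_eq_integral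
    by (intro integral_mono integrable_mult_right integrable_indicator_atMost int)
       (use \<open>\<epsilon> > 0\<close> in \<open>auto split: split_indicator simp: exp_add [symmetric]\<close>)
  then show ?thesis by simp
qed

text \<open>Half of the exponential decay absorbs the moment constant. The guard
  \<open>cdf M (-k) > 0\<close> excludes the default value \<open>ln 0 = 0\<close>.\<close>

lemma ln_cdf_linear_lower_bound:
  assumes int: "integrable M (\<lambda>x. exp (- \<epsilon> * x))" and \<epsilon>: "\<epsilon> > 0"
  shows "\<forall>\<^sub>F k in at_top. cdf M (-k) > 0 \<longrightarrow> - ln (cdf M (-k)) \<ge> \<epsilon> / 2 * k"
proof -
  define C where "C = (LINT x|M. exp (- \<epsilon> * x))"
  have "\<forall>\<^sub>F k in at_top. C \<le> exp (\<epsilon> / 2 * k)"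
    using \<epsilon> by real_asymp
  then show ?thesis
  proof eventually_elim
    case (elim k)
    have "cdf M (-k) \<le> exp (- \<epsilon> * k) * C"
      using cdf_le_exp_moment[OF int \<epsilon>, of "-k"] by (simp add: C_def)
    also have "\<dots> \<le> exp (- \<epsilon> * k) * exp (\<epsilon> / 2 * k)"
      using elim by (intro mult_left_mono) auto
    also have "\<dots> = exp (- (\<epsilon> / 2 * k))"
      by (simp add: exp_add [symmetric])
    finally have le: "cdf M (-k) \<le> exp (- (\<epsilon> / 2 * k))" .
    show ?case
    proof
      assume "cdf M (-k) > 0"
      then have "ln (cdf M (-k)) \<le> ln (exp (- (\<epsilon> / 2 * k)))"
        using le by (subst ln_le_cancel_iff) (auto simp only: exp_gt_zero)
      then show "- ln (cdf M (-k)) \<ge> \<epsilon> / 2 * k"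
        by simp
    qed
  qed
qed

end

text \<open>The bound \<open>exp (-k) * cdf M (-k)\<close> settles one side. For the other, passing
  to the lower strike \<open>- ((1 + \<delta>) * k)\<close> multiplies the logarithm of the
  distribution function by about \<open>(1 + \<delta>) powr \<alpha>\<close>, which is close to
  1.\<close>

lemma put_price_asymp_equiv:
  assumes M: "prob_space M" "sets M = sets borel"
    and g: "regvar \<alpha> (\<lambda>k. - ln (cdf M (-k)))"
  shows "(\<lambda>k. - ln (put_price M (-k))) \<sim>[at_top] (\<lambda>k. k - ln (cdf M (-k)))"
proof (rule asymp_equiv_realI)
  have gpos: "\<forall>\<^sub>F k in at_top. - ln (cdf M (-k)) > 0"
    using g by (simp add: regvar_def)
  then show "\<forall>\<^sub>F k in at_top. k - ln (cdf M (-k)) > 0"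
    using eventually_gt_at_top[of 0] by eventually_elim auto
  \<comment> \<open>A zero of the distribution function would make its logarithm 0, against
    \<open>gpos\<close>.\<close>
  have Fpos: "\<forall>\<^sub>F k in at_top. cdf M (-k) > 0"
    using gpos by eventually_elim (auto simp: cdf_def less_le)
  fix \<epsilon> :: real assume \<epsilon>: "0 < \<epsilon>" "\<epsilon> < 1"
  have "((\<lambda>\<delta>. (1 + \<delta>) powr \<alpha>) \<longlongrightarrow> 1) (at_right 0)"
    by real_asymp
  then have "\<forall>\<^sub>F \<delta> in at_right 0. (1 + \<delta>) powr \<alpha> < 1 + \<epsilon> / 2"
    using \<epsilon> by (intro order_tendstoD) auto
  then have "\<forall>\<^sub>F \<delta> in at_right 0. (1 + \<delta>) powr \<alpha> < 1 + \<epsilon> / 2 \<and> \<delta> > 0"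
    using eventually_at_right_less[of 0] by eventually_elim auto
  then obtain \<delta> where \<delta>: "(1 + \<delta>) powr \<alpha> < 1 + \<epsilon> / 2" "\<delta> > 0"
    using eventually_happens'[OF trivial_limit_at_right_real] by blast
  have "((\<lambda>k. - ln (cdf M (- ((1 + \<delta>) * k))) / - ln (cdf M (-k))) \<longlongrightarrow> (1 + \<delta>) powr \<alpha>) at_top"
    using g \<delta> by (simp add: regvar_def)
  then have quot: "\<forall>\<^sub>F k in at_top. - ln (cdf M (- ((1 + \<delta>) * k))) / - ln (cdf M (-k)) < 1 + \<epsilon> / 2"
    using \<delta> by (intro order_tendstoD) auto
  have "filterlim (\<lambda>k. (1 + \<delta>) * k) at_top at_top"
    using \<delta> by real_asymp
  note Fpos' = eventually_compose_filterlim[OF Fpos this]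
  \<comment> \<open>The first threshold for \<open>k\<close> makes
    \<open>exp (- (\<delta> * k)) \<le> 1 / 2\<close>, so half of \<open>exp (-k)\<close> survives;
    the second lets \<open>\<epsilon> * k\<close> absorb the resulting \<open>ln 2\<close>.\<close>
  from gpos Fpos Fpos' quot eventually_gt_at_top[of 0]
    eventually_ge_at_top[of "ln 2 / \<delta>"] eventually_ge_at_top[of "ln 2 / \<epsilon>"]
  show "\<forall>\<^sub>F k in at_top. (1 - \<epsilon>) * (k - ln (cdf M (-k))) \<le> - ln (put_price M (-k)) \<and>
      - ln (put_price M (-k)) \<le> (1 + \<epsilon>) * (k - ln (cdf M (-k)))"
  proof eventually_elim
    case (elim k)
    let ?F = "cdf M (-k)" and ?F' = "cdf M (- ((1 + \<delta>) * k))"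
    have k: "ln 2 \<le> \<delta> * k" "ln 2 \<le> \<epsilon> * k"
      using elim \<delta> \<epsilon> by (auto simp: field_simps)
    have "exp (- (\<delta> * k)) \<le> exp (- ln 2)"
      using k by simp
    then have "exp (- (\<delta> * k)) \<le> 1 / 2"
      by (simp add: exp_minus)
    then have "exp (-k) * exp (- (\<delta> * k)) \<le> exp (-k) * (1 / 2)"
      by (intro mult_left_mono) auto
    moreover have "exp (- ((1 + \<delta>) * k)) = exp (-k) * exp (- (\<delta> * k))"
      by (simp add: exp_add [symmetric] algebra_simps)
    ultimately have "exp (-k) / 2 \<le> exp (-k) - exp (- ((1 + \<delta>) * k))"
      by simp
    then have "exp (-k) / 2 * ?F' \<le> (exp (-k) - exp (- ((1 + \<delta>) * k))) * ?F'"
      using elim by (intro mult_right_mono) auto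
    also have "\<dots> \<le> put_price M (-k)"
      using elim \<delta> by (intro put_price_ge M) (auto simp: algebra_simps)
    finally have ge: "exp (-k) / 2 * ?F' \<le> put_price M (-k)" .
    moreover have pos': "exp (-k) / 2 * ?F' > 0"
      using elim by simp
    ultimately have pos: "put_price M (-k) > 0"
      by linarith
    have "ln (exp (-k) / 2 * ?F') \<le> ln (put_price M (-k))"
      using ge pos pos' by (subst ln_le_cancel_iff)
    moreover have "ln (exp (-k) / 2 * ?F') = - k - ln 2 + ln ?F'"
      using elim by (simp add: ln_mult ln_div)
    moreover have "- ln ?F' \<le> (1 + \<epsilon> / 2) * - ln ?F"
      using elim(4) unfolding pos_divide_less_eq[OF elim(1)] by (rule less_imp_le)
    moreover have "\<epsilon> / 2 * - ln ?F \<ge> 0"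
      using elim(1) \<epsilon> by (intro mult_nonneg_nonneg) auto
    ultimately have upper: "- ln (put_price M (-k)) \<le> (1 + \<epsilon>) * (k - ln ?F)"
      using k by (simp add: algebra_simps)
    have "ln (put_price M (-k)) \<le> ln (exp (-k) * ?F)"
      using pos elim(2) put_price_le[OF M, of "-k"] by (subst ln_le_cancel_iff) auto
    then have "k - ln ?F \<le> - ln (put_price M (-k))"
      using elim(2) by (simp add: ln_mult)
    moreover have "\<epsilon> * (k - ln ?F) \<ge> 0"
      using elim(1,5) \<epsilon> by (intro mult_nonneg_nonneg) auto
    ultimately show ?case
      using upper by (simp add: algebra_simps)
  qed
qed

text \<open>The price is at most \<open>exp (-k) * cdf M (-k)\<close>, and the moment condition adds
  decay at rate \<open>\<epsilon> / 2\<close>. This keeps the argument of \<open>psi\<close> away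
  from 0, as the bracket requires.\<close>

lemma put_price_linear_bound:
  assumes M: "prob_space M" "sets M = sets borel"
    and int: "integrable M (\<lambda>x. exp (- \<epsilon> * x))" and \<epsilon>: "\<epsilon> > 0"
    and pos: "\<forall>\<^sub>F k in at_top. put_price M (-k) > 0"
  shows "\<forall>\<^sub>F k in at_top. -1 - ln (put_price M (-k)) / k \<ge> \<epsilon> / 2"
  using ln_cdf_linear_lower_bound[OF M int \<epsilon>] pos eventually_gt_at_top[of 0]
proof eventually_elim
  case (elim k)
  have le: "put_price M (-k) \<le> exp (-k) * cdf M (-k)"
    by (rule put_price_le[OF M])
  then have "exp (-k) * cdf M (-k) > 0"
    using elim(2) by linarith
  then have F: "cdf M (-k) > 0"
    by (simp add: zero_less_mult_iff)
  have "ln (put_price M (-k)) \<le> ln (exp (-k) * cdf M (-k))"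
    using le elim(2) F by (subst ln_le_cancel_iff) auto
  also have "\<dots> = - k + ln (cdf M (-k))"
    using F by (simp add: ln_mult)
  finally have "\<epsilon> / 2 * k \<le> (-1 - ln (put_price M (-k)) / k) * k"
    using elim F by (simp add: algebra_simps)
  then show ?case
    using elim by simp
qed

section \<open>The chain of implications\<close>

lemma regvar_cdf_imp_regvar_put:
  assumes M: "prob_space M" "sets M = sets borel"
    and int: "integrable M (\<lambda>x. exp (- \<epsilon> * x))" and \<epsilon>: "\<epsilon> > 0"
    and g: "regvar \<alpha> (\<lambda>k. - ln (cdf M (-k)))"
  shows "regvar \<alpha> (\<lambda>k. - ln (put_price M (-k)))"
proof -
  have gpos: "\<forall>\<^sub>F k in at_top. - ln (cdf M (-k)) > 0"
    using g by (simp add: regvar_def)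
  \<comment> \<open>The moment condition makes \<open>- ln (cdf M (-k))\<close> at least linear, so
    adding \<open>k\<close> preserves the index.\<close>
  have "\<forall>\<^sub>F k in at_top. \<epsilon> / 2 * k \<le> - ln (cdf M (-k))"
    using ln_cdf_linear_lower_bound[OF M int \<epsilon>] gpos
    by eventually_elim (auto simp: cdf_def less_le)
  then have "regvar \<alpha> (\<lambda>k. k + - ln (cdf M (-k)))"
    using \<epsilon> by (intro regvar_add_ident[OF g, of "\<epsilon> / 2"]) auto
  then have reg: "regvar \<alpha> (\<lambda>k. k - ln (cdf M (-k)))"
    by simp
  have [measurable]: "put_price M \<in> borel_measurable borel"
    by (rule borel_measurable_mono[OF mono_put_price[OF M]])
  have "\<forall>\<^sub>F k in at_top. - ln (put_price M (-k)) > 0"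
    using asymp_equiv_eventually_pos_iff[OF put_price_asymp_equiv[OF M g]] reg
    by (auto simp: regvar_def elim: eventually_elim2)
  then show ?thesis
    by (intro regvar_asymp_equiv[OF reg put_price_asymp_equiv[OF M g]]) measurable
qed

lemma regvar_put_imp_impvol:
  assumes M: "prob_space M" "sets M = sets borel"
    and int: "integrable M (\<lambda>x. exp (- \<epsilon> * x))" and \<epsilon>: "\<epsilon> > 0"
    and P: "regvar \<alpha> (\<lambda>k. - ln (put_price M (-k)))"
  shows "(\<lambda>k. (impvol M (-k))\<^sup>2 / k) \<sim>[at_top] (\<lambda>k. psi (-1 - ln (put_price M (-k)) / k))"
    and "\<forall>\<^sub>F k in at_top. -1 - ln (put_price M (-k)) / k > 0"
proof -
  have "put_price M x \<ge> 0" for x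
    unfolding put_price_eq by (intro integral_nonneg_AE) auto
  moreover have "\<forall>\<^sub>F k in at_top. - ln (put_price M (-k)) > 0"
    using P by (simp add: regvar_def)
  ultimately have pos: "\<forall>\<^sub>F k in at_top. put_price M (-k) > 0"
    by (auto simp: less_le elim!: eventually_mono)
  note ge = put_price_linear_bound[OF M int \<epsilon> pos]
  show "(\<lambda>k. (impvol M (-k))\<^sup>2 / k) \<sim>[at_top] (\<lambda>k. psi (-1 - ln (put_price M (-k)) / k))"
    using \<epsilon> by (intro impvol_asymp_equiv[OF _ pos ge]) auto
  show "\<forall>\<^sub>F k in at_top. -1 - ln (put_price M (-k)) / k > 0"
    using ge by eventually_elim (use \<epsilon> in linarith)
qed

text \<open>Subtracting \<open>k\<close> from both sides of \<open>P k \<sim> k + G k\<close> could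
  lose the equivalence by cancellation. The relative error is magnified by
  \<open>(k + G k) / G k\<close>, and \<open>G k \<ge> \<epsilon> / 2 * k\<close> bounds this factor
  by \<open>1 + 2 / \<epsilon>\<close>.\<close>

lemma regvar_cdf_imp_impvol:
  assumes M: "prob_space M" "sets M = sets borel"
    and int: "integrable M (\<lambda>x. exp (- \<epsilon> * x))" and \<epsilon>: "\<epsilon> > 0"
    and g: "regvar \<alpha> (\<lambda>k. - ln (cdf M (-k)))"
  shows "(\<lambda>k. (impvol M (-k))\<^sup>2 / k) \<sim>[at_top] (\<lambda>k. psi (- ln (cdf M (-k)) / k))"
proof -
  define G P where "G k = - ln (cdf M (-k))" and "P k = - ln (put_price M (-k))" for k
  note put = regvar_put_imp_impvol[OF M int \<epsilon> regvar_cdf_imp_regvar_put[OF M int \<epsilon> g]]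
  have Gpos: "\<forall>\<^sub>F k in at_top. G k > 0"
    using g by (simp add: regvar_def G_def)
  have Gge: "\<forall>\<^sub>F k in at_top. \<epsilon> / 2 * k \<le> G k"
    using ln_cdf_linear_lower_bound[OF M int \<epsilon>] Gpos
    by eventually_elim (auto simp: cdf_def less_le G_def)
  have "\<forall>\<^sub>F k in at_top. k + G k \<noteq> 0"
    using Gpos eventually_gt_at_top[of 0] by eventually_elim auto
  then have "((\<lambda>k. P k / (k + G k)) \<longlongrightarrow> 1) at_top"
    using put_price_asymp_equiv[OF M g] unfolding P_def G_def
    by (intro asymp_equivD_strong) (auto elim: eventually_mono)
  then have "((\<lambda>k. P k / (k + G k) - 1) \<longlongrightarrow> 0) at_top"
    by (simp add: LIM_zero)
  then have "((\<lambda>k. (1 + 2 / \<epsilon>) * \<bar>P k / (k + G k) - 1\<bar>) \<longlongrightarrow> 0) at_top"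
    by (intro tendsto_mult_right_zero tendsto_rabs_zero)
  then have "((\<lambda>k. (-1 + P k / k) / (G k / k) - 1) \<longlongrightarrow> 0) at_top"
  proof (rule Lim_null_comparison[rotated])
    show "\<forall>\<^sub>F k in at_top. norm ((-1 + P k / k) / (G k / k) - 1) \<le> (1 + 2 / \<epsilon>) * \<bar>P k / (k + G k) - 1\<bar>"
      using Gpos Gge eventually_gt_at_top[of 0]
    proof eventually_elim
      case (elim k)
      define S where "S = k + G k"
      have "S > 0" using elim by (simp add: S_def)
      then have "(k + G k) / G k * (P k / (k + G k) - 1) = (P k - S) / G k"
        using elim unfolding S_def [symmetric] by (simp add: field_simps)
      also have "\<dots> = (-1 + P k / k) / (G k / k) - 1"
        using elim by (simp add: S_def field_simps)
      finally have "norm ((-1 + P k / k) / (G k / k) - 1) = norm ((k + G k) / G k * (P k / (k + G k) - 1))"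
        by (simp only:)
      also have "\<dots> = (k + G k) / G k * \<bar>P k / (k + G k) - 1\<bar>"
        using elim by (simp add: abs_mult)
      also have "\<dots> \<le> (1 + 2 / \<epsilon>) * \<bar>P k / (k + G k) - 1\<bar>"
        using elim \<epsilon> by (intro mult_right_mono) (auto simp: field_simps)
      finally show ?case .
    qed
  qed
  then have "((\<lambda>k. (-1 + P k / k) / (G k / k)) \<longlongrightarrow> 1) at_top"
    by (simp add: LIM_zero_iff)
  then have "(\<lambda>k. -1 + P k / k) \<sim>[at_top] (\<lambda>k. G k / k)"
    by (rule asymp_equivI')
  then have "(\<lambda>k. psi (-1 + P k / k)) \<sim>[at_top] (\<lambda>k. psi (G k / k))"
  proof (rule psi_asymp_equiv)
    show "\<forall>\<^sub>F k in at_top. -1 + P k / k > 0"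
      using put(2) by (simp add: P_def)
    show "\<forall>\<^sub>F k in at_top. G k / k > 0"
      using Gpos eventually_gt_at_top[of 0] by eventually_elim auto
  qed
  with put(1) show ?thesis
    by (simp add: P_def G_def asymp_equiv_trans)
qed

lemma regvar_density_imp_cdf:
  assumes M: "prob_space M" "sets M = sets borel" and \<alpha>: "\<alpha> > 0"
    and f: "has_density M f" and h: "regvar \<alpha> (\<lambda>k. - ln (f (-k)))"
  shows "regvar \<alpha> (\<lambda>k. - ln (cdf M (-k)))"
proof (rule regvar_asymp_equiv[OF h density_tail_asymp_equiv[OF M(1) f h \<alpha>]])
  have [measurable]: "cdf M \<in> borel_measurable borel"
    by (rule borel_measurable_mono[OF mono_cdf[OF M]])
  show "(\<lambda>k. - ln (cdf M (-k))) \<in> borel_measurable borel"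
    by measurable
  show "\<forall>\<^sub>F k in at_top. - ln (cdf M (-k)) > 0"
    using asymp_equiv_eventually_pos_iff[OF density_tail_asymp_equiv[OF M(1) f h \<alpha>]] h
    by (auto simp: regvar_def elim: eventually_elim2)
qed

lemma regvar_density_imp_impvol:
  assumes M: "prob_space M" "sets M = sets borel" and \<alpha>: "\<alpha> > 0"
    and int: "integrable M (\<lambda>x. exp (- \<epsilon> * x))" and \<epsilon>: "\<epsilon> > 0"
    and f: "has_density M f" and h: "regvar \<alpha> (\<lambda>k. - ln (f (-k)))"
  shows "(\<lambda>k. (impvol M (-k))\<^sup>2 / k) \<sim>[at_top] (\<lambda>k. psi (- ln (f (-k)) / k))"
proof -
  note g = regvar_density_imp_cdf[OF M \<alpha> f h]
  have "(\<lambda>k. - ln (cdf M (-k)) / k) \<sim>[at_top] (\<lambda>k. - ln (f (-k)) / k)"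
    by (intro asymp_equiv_divide density_tail_asymp_equiv[OF M(1) f h \<alpha>] asymp_equiv_refl)
  moreover have "\<forall>\<^sub>F k in at_top. u k / k > 0" if "regvar \<alpha> u" for u
  proof -
    have "\<forall>\<^sub>F k in at_top. u k > 0"
      using that by (simp add: regvar_def)
    then show ?thesis
      using eventually_gt_at_top[of 0] by eventually_elim simp
  qed
  ultimately have "(\<lambda>k. psi (- ln (cdf M (-k)) / k)) \<sim>[at_top] (\<lambda>k. psi (- ln (f (-k)) / k))"
    using g h by (intro psi_asymp_equiv)
  with regvar_cdf_imp_impvol[OF M int \<epsilon> g] show ?thesis
    by (rule asymp_equiv_trans)
qed

lemma asymp_equiv_psi_at_top:
  assumes "v \<sim>[F] (\<lambda>k. psi (- L k / k))" and "filterlim (\<lambda>k. - L k / k) at_top F"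
  shows "v \<sim>[F] (\<lambda>k. 1 / (-2 * L k / k))"
proof -
  have "(\<lambda>k. psi (- L k / k)) \<sim>[F] (\<lambda>k. 1 / (2 * (- L k / k)))"
    using psi_asymp_equiv_at_top assms(2) by (rule asymp_equiv_compose')
  moreover have "1 / (2 * (- L k / k)) = 1 / (-2 * L k / k)" for k
    by simp
  ultimately show ?thesis
    using asymp_equiv_trans[OF assms(1)] by (simp only:)
qed

theorem theorem2:
  fixes M :: "real measure" and \<alpha> :: real
  assumes "prob_space M" and "sets M = sets borel"
    and "integrable M exp" and "(LINT x|M. exp x) = 1"
    and "\<alpha> > 0"
    and IL: "\<exists>\<epsilon>>0. integrable M (\<lambda>x. exp (- \<epsilon> * x))"
  shows
    "(\<forall>f. has_density M f \<and> regvar \<alpha> (\<lambda>k. - ln (f (-k)))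
        \<longrightarrow> regvar \<alpha> (\<lambda>k. - ln (cdf M (-k))))
   \<and> (regvar \<alpha> (\<lambda>k. - ln (cdf M (-k))) \<longrightarrow> regvar \<alpha> (\<lambda>k. - ln (put_price M (-k))))
   \<and> (regvar \<alpha> (\<lambda>k. - ln (put_price M (-k))) \<longrightarrow>
        (\<lambda>k. (impvol M (-k))\<^sup>2 / k) \<sim>[at_top] (\<lambda>k. psi (-1 - ln (put_price M (-k)) / k)))
   \<and> (regvar \<alpha> (\<lambda>k. - ln (cdf M (-k))) \<longrightarrow>
        (\<lambda>k. - ln (put_price M (-k))) \<sim>[at_top] (\<lambda>k. k - ln (cdf M (-k))) \<and>
        (\<lambda>k. (impvol M (-k))\<^sup>2 / k) \<sim>[at_top] (\<lambda>k. psi (- ln (cdf M (-k)) / k)))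
   \<and> (\<forall>f. has_density M f \<and> regvar \<alpha> (\<lambda>k. - ln (f (-k))) \<longrightarrow>
        (\<lambda>k. - ln (f (-k))) \<sim>[at_top] (\<lambda>k. - ln (cdf M (-k))) \<and>
        (\<lambda>k. (impvol M (-k))\<^sup>2 / k) \<sim>[at_top] (\<lambda>k. psi (- ln (f (-k)) / k)))
   \<and> (\<forall>f. has_density M f \<and> regvar \<alpha> (\<lambda>k. - ln (f (-k))) \<and>
        filterlim (\<lambda>k. - ln (f (-k)) / k) at_top at_top \<longrightarrow>
        (\<lambda>k. (impvol M (-k))\<^sup>2 / k) \<sim>[at_top] (\<lambda>k. 1 / (-2 * ln (f (-k)) / k)))
   \<and> (regvar \<alpha> (\<lambda>k. - ln (cdf M (-k))) \<and>
        filterlim (\<lambda>k. - ln (cdf M (-k)) / k) at_top at_top \<longrightarrow>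
        (\<lambda>k. (impvol M (-k))\<^sup>2 / k) \<sim>[at_top] (\<lambda>k. 1 / (-2 * ln (cdf M (-k)) / k)))
   \<and> (regvar \<alpha> (\<lambda>k. - ln (put_price M (-k))) \<and>
        filterlim (\<lambda>k. - ln (put_price M (-k)) / k) at_top at_top \<longrightarrow>
        (\<lambda>k. (impvol M (-k))\<^sup>2 / k) \<sim>[at_top] (\<lambda>k. 1 / (-2 * ln (put_price M (-k)) / k)))"
proof -
  note M = assms(1,2)
  obtain \<epsilon> where \<epsilon>: "\<epsilon> > 0" and int: "integrable M (\<lambda>x. exp (- \<epsilon> * x))"
    using IL by blast
  \<comment> \<open>When \<open>- ln (put_price M (-k)) / k\<close> tends to infinity, the shift by
    \<open>-1\<close> in the argument of \<open>psi\<close> is asymptotically negligible.\<close>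
  have put_at_top: "(\<lambda>k. (impvol M (-k))\<^sup>2 / k) \<sim>[at_top] (\<lambda>k. psi (- ln (put_price M (-k)) / k))"
    if P: "regvar \<alpha> (\<lambda>k. - ln (put_price M (-k)))"
      and lim: "filterlim (\<lambda>k. - ln (put_price M (-k)) / k) at_top at_top"
  proof -
    define L where "L k = - ln (put_price M (-k)) / k" for k
    have L: "filterlim L at_top at_top"
      using lim by (simp add: L_def[abs_def])
    have "(\<lambda>y::real. -1 + y) \<sim>[at_top] (\<lambda>y. y)"
      by real_asymp
    then have "(\<lambda>k. -1 + L k) \<sim>[at_top] L"
      by (rule asymp_equiv_compose') (rule L)
    moreover have "\<forall>\<^sub>F k in at_top. -1 + L k > 0"
      using regvar_put_imp_impvol(2)[OF M int \<epsilon> P] by (simp add: L_def)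
    moreover have "\<forall>\<^sub>F k in at_top. L k > 0"
      using L by (simp add: filterlim_at_top_dense)
    ultimately have "(\<lambda>k. psi (-1 + L k)) \<sim>[at_top] (\<lambda>k. psi (L k))"
      by (rule psi_asymp_equiv)
    with regvar_put_imp_impvol(1)[OF M int \<epsilon> P] show ?thesis
      by (simp add: L_def asymp_equiv_trans)
  qed
  note f_cdf = regvar_density_imp_cdf[OF M \<open>\<alpha> > 0\<close>]
    and f_ln_cdf = asymp_equiv_symI[OF density_tail_asymp_equiv[OF M(1) _ _ \<open>\<alpha> > 0\<close>]]
    and cdf_put = regvar_cdf_imp_regvar_put[OF M int \<epsilon>]
    and cdf_ln_put = put_price_asymp_equiv[OF M]
    and f_impvol = regvar_density_imp_impvol[OF M \<open>\<alpha> > 0\<close> int \<epsilon>]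
    and cdf_impvol = regvar_cdf_imp_impvol[OF M int \<epsilon>]
    and put_impvol = regvar_put_imp_impvol(1)[OF M int \<epsilon>]
  show ?thesis
    by (intro conjI allI impI; (elim conjE)?)
       (rule f_cdf cdf_put put_impvol cdf_ln_put cdf_impvol f_ln_cdf f_impvol
          asymp_equiv_psi_at_top[OF f_impvol] asymp_equiv_psi_at_top[OF cdf_impvol]
          asymp_equiv_psi_at_top[OF put_at_top]; assumption)+
qed

end
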